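(* Let $k\ge1$ and let $u_1,\dots,u_k$ be indeterminates (treated as scalars). Define operators on polynomials in $\mathbf p$ by $$B^{(k)}_m f:=(m-1)!\,\Theta_Y\Big(Y_+\prod_{i=1}^k(\Lambda_Y+u_i)\Big)^m\Big(\frac{y_0}{1+b}f\Big),\quad m\ge1,$$ $$\Omega^{(k)}_Yf:=\Theta_YY_+\prod_{j=1}^k(\Lambda_Y+u_j)\Lambda_Y\Big(\frac{y_0}{1+b}f\Big).$$ Then $B^{(k)}_1f=\Theta_YY_+\prod_{j=1}^k(\Lambda_Y+u_j)\big(\frac{y_0}{1+b}f\big)$ and $B^{(k)}_{m+1}=[\Omega^{(k)}_Y,B^{(k)}_m]$ for all $m\ge1$, as operators on polynomials in $p_1,p_2,\dots$ (with coefficients in $\mathbb Q(b)$, the $u_i$ being scalars).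
   Context: Variables $b$, $\mathbf p=(p_i)_{i\ge1}$, $\bm y=(y_i)_{i\ge0}$. Operators: $\Theta_Y=\sum_{i\ge1}p_i\frac{\partial}{\partial y_i}$; $Y_+=\sum_{i\ge0}y_{i+1}\frac{\partial}{\partial y_i}$; $\Lambda_Y=(1+b)\sum_{i,j\ge1}iy_{i+j-1}\frac{\partial^2}{\partial p_i\partial y_{j-1}}+\sum_{i,j\ge1}y_{i-1}p_j\frac{\partial}{\partial y_{i+j-1}}+b\sum_{i\ge0}iy_i\frac{\partial}{\partial y_i}$. $[A,B]=AB-BA$. *)

theory Defs
  imports "HOL-Library.Poly_Mapping"
begin

text \<open>Variables p_i (i \<ge> 1) and y_i (i \<ge> 0). Polynomials with coefficients in a
  field 'a of characteristic 0 (e.g. Q(b,u_1,...,u_k)) are finitely supported maps from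
  monomials (finitely supported exponent maps from variables to nat) to coefficients.\<close>

datatype var = P nat | Y nat

type_synonym 'a pyp = "(var \<Rightarrow>\<^sub>0 nat) \<Rightarrow>\<^sub>0 'a"

definition Const :: "'a::field_char_0 \<Rightarrow> 'a pyp" where
  "Const c = Poly_Mapping.single 0 c"

definition Var :: "var \<Rightarrow> 'a::field_char_0 pyp" where
  "Var v = Poly_Mapping.single (Poly_Mapping.single v 1) 1"

definition pd :: "var \<Rightarrow> 'a::field_char_0 pyp \<Rightarrow> 'a pyp" where
  "pd v f = Sum_any (\<lambda>m::var \<Rightarrow>\<^sub>0 nat. Poly_Mapping.single (m - Poly_Mapping.single v 1)
                         (Poly_Mapping.lookup f m * of_nat (Poly_Mapping.lookup m v)))"

definition p_only :: "'a::field_char_0 pyp \<Rightarrow> bool" where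
  "p_only f \<longleftrightarrow> (\<forall>m::var \<Rightarrow>\<^sub>0 nat. Poly_Mapping.lookup f m \<noteq> 0 \<longrightarrow> (\<forall>i. Poly_Mapping.lookup m (Y i) = 0))"

definition ThetaY :: "'a::field_char_0 pyp \<Rightarrow> 'a pyp" where
  "ThetaY f = Sum_any (\<lambda>i. if i \<ge> 1 then Var (P i) * pd (Y i) f else 0)"

definition Yplus :: "'a::field_char_0 pyp \<Rightarrow> 'a pyp" where
  "Yplus f = Sum_any (\<lambda>i. Var (Y (i + 1)) * pd (Y i) f)"

definition LambdaY :: "'a::field_char_0 \<Rightarrow> 'a pyp \<Rightarrow> 'a pyp" where
  "LambdaY b f =
     Const (1 + b) * Sum_any (\<lambda>(i, j). if i \<ge> 1 \<and> j \<ge> 1 then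
         Const (of_nat i) * Var (Y (i + j - 1)) * pd (P i) (pd (Y (j - 1)) f) else 0)
   + Sum_any (\<lambda>(i, j). if i \<ge> 1 \<and> j \<ge> 1 then
         Var (Y (i - 1)) * Var (P j) * pd (Y (i + j - 1)) f else 0)
   + Const b * Sum_any (\<lambda>i. Const (of_nat i) * Var (Y i) * pd (Y i) f)"

fun prodL :: "'a::field_char_0 \<Rightarrow> (nat \<Rightarrow> 'a) \<Rightarrow> nat \<Rightarrow> 'a pyp \<Rightarrow> 'a pyp" where
  "prodL b u 0 = id"
| "prodL b u (Suc n) = (\<lambda>f. LambdaY b f + Const (u (Suc n)) * f) \<circ> prodL b u n"

definition mulY0 :: "'a::field_char_0 \<Rightarrow> 'a pyp \<Rightarrow> 'a pyp" where
  "mulY0 b f = Const (1 / (1 + b)) * Var (Y 0) * f"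

definition Bop :: "'a::field_char_0 \<Rightarrow> (nat \<Rightarrow> 'a) \<Rightarrow> nat \<Rightarrow> nat \<Rightarrow> 'a pyp \<Rightarrow> 'a pyp" where
  "Bop b u k m f = Const (fact (m - 1)) *
      ThetaY (((Yplus \<circ> prodL b u k) ^^ m) (mulY0 b f))"

definition OmegaY :: "'a::field_char_0 \<Rightarrow> (nat \<Rightarrow> 'a) \<Rightarrow> nat \<Rightarrow> 'a pyp \<Rightarrow> 'a pyp" where
  "OmegaY b u k f = ThetaY (Yplus (prodL b u k (LambdaY b (mulY0 b f))))"

end

theory Submission
  imports Defs "HOL-Library.Function_Algebras"
begin

text \<open>
  Identify \<open>y\<^sub>a\<close> with \<open>z\<^sup>a\<close> and think of \<open>p\<^sub>j\<close> as the power sum \<open>x\<^sub>1\<^sup>j + x\<^sub>2\<^sup>j + \<dots>\<close> with \<open>z = x\<^sub>1\<close>. On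
  polynomials linear in the \<open>y\<^sub>a\<close>, \<open>LambdaY\<close> is then the operator
  \<open>D\<^sub>1 = (1 + b) x\<^sub>1\<partial>\<^sub>1 + (\<Sum>j \<noteq> 1. x\<^sub>j / (x\<^sub>1 - x\<^sub>j) (1 - s\<^sub>1\<^sub>j))\<close>, \<open>Yplus\<close> is multiplication by \<open>x\<^sub>1\<close>, and
  \<open>ThetaY\<close> is \<open>x\<^sub>1 g(x\<^sub>1) \<mapsto> \<Sum>i. x\<^sub>i g(x\<^sub>i)\<close>. Put \<open>A\<^sub>i = x\<^sub>i (\<Prod>j. D\<^sub>i + u\<^sub>j)\<close>. Up to scalars, the two operators
  in the theorem are \<open>\<Sum>i. A\<^sub>i\<^sup>m\<close> and \<open>\<Sum>i. A\<^sub>i D\<^sub>i\<close> acting on symmetric functions. The relations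
  \<open>D\<^sub>1 x\<^sub>2 = x\<^sub>2 (D\<^sub>1 - s\<^sub>1\<^sub>2)\<close> and \<open>[D\<^sub>1, D\<^sub>2] = (D\<^sub>1 - D\<^sub>2) s\<^sub>1\<^sub>2\<close> of the degenerate double affine Hecke algebra imply that the
  \<open>A\<^sub>i\<close> commute, that \<open>[A\<^sub>2 D\<^sub>2, A\<^sub>1] = - A\<^sub>1 A\<^sub>2 s\<^sub>1\<^sub>2\<close>, and that
  \<open>[A\<^sub>1 D\<^sub>1, A\<^sub>1] = (1 + b) A\<^sub>1\<^sup>2 + (\<Sum>j \<noteq> 1. A\<^sub>1 A\<^sub>j s\<^sub>1\<^sub>j)\<close>. Hence \<open>[\<Sum>i. A\<^sub>i D\<^sub>i, A\<^sub>1] = (1 + b) A\<^sub>1\<^sup>2\<close>, and so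
  \<open>[\<Sum>i. A\<^sub>i D\<^sub>i, \<Sum>i. A\<^sub>i\<^sup>m] = (1 + b) m (\<Sum>i. A\<^sub>i\<^sup>m\<^sup>+\<^sup>1)\<close>. With infinitely many \<open>x\<^sub>i\<close> the argument only needs two of them
  singled out, the remaining ones entering through the \<open>p\<^sub>j\<close>.
\<close>

section \<open>Finite sums and iterated operators\<close>

text \<open>This and the next two facts bring reversed sums, partial sums and single terms to the
  common range \<open>m \<le> N\<close>, so that identities can be checked coefficient by
  coefficient.\<close>

lemma sum_reflect_le:
  fixes h :: "nat \<Rightarrow> 'b::comm_monoid_add"
  assumes "r \<le> Suc N"
  shows "(\<Sum>n<r. h (N - n)) = (\<Sum>m\<le>N. if N < m + r then h m else 0)"
proof -
  have "(\<Sum>n<r. h (N - n)) = (\<Sum>m\<in>{m\<in>{..N}. N < m + r}. h m)"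
    by (rule sum.reindex_bij_witness[where i="\<lambda>m. N - m" and j="\<lambda>n. N - n"]) (use assms in auto)
  then show ?thesis
    unfolding sum.inter_filter[OF finite_atMost] .
qed

lemma sum_lessThan_le:
  fixes h :: "nat \<Rightarrow> 'b::comm_monoid_add"
  assumes "r \<le> Suc N"
  shows "(\<Sum>n<r. h n) = (\<Sum>m\<le>N. if m < r then h m else 0)"
proof -
  have "(\<Sum>n<r. h n) = (\<Sum>m\<in>{m\<in>{..N}. m < r}. h m)"
    by (rule sum.cong) (use assms in auto)
  then show ?thesis
    unfolding sum.inter_filter[OF finite_atMost] .
qed

lemma single_term_le:
  fixes h :: "nat \<Rightarrow> 'b::comm_monoid_add"
  assumes "r \<le> N"
  shows "h r = (\<Sum>m\<le>N. if m = r then h m else 0)"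
  using assms by simp

text \<open>Each \<open>n\<close> is counted once for every \<open>m\<close> with
  \<open>n < m < c\<close>.\<close>

lemma sum_lessThan_lessThan:
  fixes h :: "nat \<Rightarrow> 'b::comm_ring_1"
  shows "(\<Sum>m<c. \<Sum>n<m. h n) = (\<Sum>n<c. of_nat (c - 1 - n) * h n)"
proof (induction c)
  case (Suc c)
  have "(\<Sum>n<c. h n) + (\<Sum>n<c. of_nat (c - 1 - n) * h n) = (\<Sum>n<c. of_nat (c - n) * h n)"
    unfolding sum.distrib[symmetric]
  proof (rule sum.cong[OF refl])
    fix n assume "n \<in> {..<c}"
    then have "c - n = Suc (c - 1 - n)" by auto
    then show "h n + of_nat (c - 1 - n) * h n = of_nat (c - n) * h n"
      by (simp add: algebra_simps)
  qed
  then show ?case using Suc by (simp add: add.commute)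
qed simp

text \<open>The product of the factors \<open>T + U i\<close> in the order of \<open>prodL\<close>;
  an abstract \<open>U\<close> covers scalars acting on functions of one or of two indices.\<close>

primrec polyop :: "('v::plus \<Rightarrow> 'v) \<Rightarrow> (nat \<Rightarrow> 'v \<Rightarrow> 'v) \<Rightarrow> nat \<Rightarrow> 'v \<Rightarrow> 'v" where
  "polyop T U 0 g = g"
| "polyop T U (Suc n) g = T (polyop T U n g) + U (Suc n) (polyop T U n g)"

lemma polyop_intertwine:
  assumes "\<And>g. H (T g) = T' (H g)" "\<And>n g. H (U n g) = U' n (H g)" "\<And>g h. H (g + h) = H g + H h"
  shows "H (polyop T U n g) = polyop T' U' n (H g)"
  by (induction n) (simp_all add: assms)

lemma polyop_add:
  fixes T :: "'v::ab_semigroup_add \<Rightarrow> 'v"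
  assumes "\<And>g h. T (g + h) = T g + T h" "\<And>n g h. U n (g + h) = U n g + U n h"
  shows "polyop T U n (g + h) = polyop T U n g + polyop T U n h"
  by (induction n) (simp_all add: assms ac_simps)

lemma funpow_intertwine:
  assumes "\<And>g. H (T g) = T' (H g)"
  shows "H ((T ^^ n) g) = (T' ^^ n) (H g)"
  by (induction n) (simp_all add: assms)

lemma funpow_additive:
  fixes T :: "'v::plus \<Rightarrow> 'v"
  assumes "\<And>g h. T (g + h) = T g + T h"
  shows "(T ^^ n) (g + h) = (T ^^ n) g + (T ^^ n) h"
  by (induction n) (simp_all add: assms)

text \<open>In the commuting case this is the sum of \<open>S\<^sup>i T\<^sup>j\<close> over \<open>i, j \<ge> 1\<close> with \<open>i + j = m + 1\<close>.\<close>

primrec mixed_sum :: "('v::{plus,zero} \<Rightarrow> 'v) \<Rightarrow> ('v \<Rightarrow> 'v) \<Rightarrow> nat \<Rightarrow> 'v \<Rightarrow> 'v" where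
  "mixed_sum S T 0 h = 0"
| "mixed_sum S T (Suc m) h = S (mixed_sum S T m h) + S ((T ^^ Suc m) h)"

section \<open>Operators with two distinguished variables\<close>

text \<open>
  \<open>E i\<close> stands for \<open>(1 + b) i \<partial>/\<partial>p\<^sub>i\<close>, \<open>Q h\<close> for \<open>\<Sum>j \<ge> 1. p\<^sub>j h\<^sub>j\<close> (so \<open>h 0\<close> is irrelevant), and \<open>S\<close> is a set of
  scalars. Elements of \<open>F[z]\<close> and \<open>F[z, w]\<close>, where \<open>F\<close> is the ring of polynomials in the \<open>p\<^sub>j\<close>, become coefficient
  functions \<open>g a\<close> and \<open>g a c\<close>. No finiteness of supports is imposed: each coefficient of a result is a finite
  expression in the input, apart from the sums hidden in \<open>Q\<close>.
\<close>

locale heisenberg =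
  fixes S :: "'f::comm_ring_1 set" and b :: 'f and u :: "nat \<Rightarrow> 'f" and k :: nat
    and E :: "nat \<Rightarrow> 'f \<Rightarrow> 'f" and Q :: "(nat \<Rightarrow> 'f) \<Rightarrow> 'f"
  assumes zero_S: "0 \<in> S" and one_S: "1 \<in> S"
    and add_S: "c \<in> S \<Longrightarrow> d \<in> S \<Longrightarrow> c + d \<in> S"
    and b_S: "b \<in> S" and u_S: "u n \<in> S"
    and E_add: "E i (f + g) = E i f + E i g"
    and E_scale: "c \<in> S \<Longrightarrow> E i (c * f) = c * E i f"
    and E_commute: "E i (E j f) = E j (E i f)"
    and Q_cong: "(\<And>j. 1 \<le> j \<Longrightarrow> h j = h' j) \<Longrightarrow> Q h = Q h'"
    and Q_add: "Q (\<lambda>j. h j + h' j) = Q h + Q h'"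
    and Q_scale: "c \<in> S \<Longrightarrow> Q (\<lambda>j. c * h j) = c * Q h"
    and Q_commute: "Q (\<lambda>i. Q (\<lambda>j. G i j)) = Q (\<lambda>j. Q (\<lambda>i. G i j))"
    and E_Q: "1 \<le> i \<Longrightarrow> E i (Q h) = Q (\<lambda>j. E i (h j)) + of_nat i * (1 + b) * h i"
begin

lemma E_0 [simp]: "E i 0 = 0"
  using E_add[of i 0 0] by simp

lemma E_minus: "E i (- f) = - E i f"
  using E_add[of i f "- f"] by (simp add: eq_neg_iff_add_eq_0 add.commute)

lemma E_sum: "E i (sum h T) = (\<Sum>t\<in>T. E i (h t))"
  by (induction T rule: infinite_finite_induct) (auto simp: E_add)

lemma E_of_nat: "E i (of_nat n * f) = of_nat n * E i f"
  by (induction n) (auto simp: E_add algebra_simps)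

lemma Q_0 [simp]: "Q (\<lambda>_. 0) = 0"
  using Q_add[of "\<lambda>_. 0" "\<lambda>_. 0"] by simp

lemma Q_minus: "Q (\<lambda>j. - h j) = - Q h"
  using Q_add[of h "\<lambda>j. - h j"] by (simp add: eq_neg_iff_add_eq_0 add.commute)

lemma Q_diff: "Q (\<lambda>j. h j - h' j) = Q h - Q h'"
  using Q_add[of h "\<lambda>j. - h' j"] by (simp add: Q_minus)

lemma Q_sum: "Q (\<lambda>j. \<Sum>t\<in>T. h t j) = (\<Sum>t\<in>T. Q (h t))"
  by (induction T rule: infinite_finite_induct) (auto simp: Q_add)

lemma Q_of_nat: "Q (\<lambda>j. of_nat n * h j) = of_nat n * Q h"
  by (induction n) (auto simp: Q_add algebra_simps)

text \<open>The coefficient form of \<open>LambdaY\<close>, with \<open>g a\<close> the coefficient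
  of \<open>Y a\<close>.\<close>

definition \<Lambda> :: "(nat \<Rightarrow> 'f) \<Rightarrow> nat \<Rightarrow> 'f" where
  "\<Lambda> g a = (\<Sum>i=1..a. E i (g (a - i))) + Q (\<lambda>j. g (a + j)) + of_nat a * (b * g a)"

definition E1 :: "(nat \<Rightarrow> nat \<Rightarrow> 'f) \<Rightarrow> nat \<Rightarrow> nat \<Rightarrow> 'f" where
  "E1 g a c = (\<Sum>i=1..a. E i (g (a - i) c))"

definition Q1 :: "(nat \<Rightarrow> nat \<Rightarrow> 'f) \<Rightarrow> nat \<Rightarrow> nat \<Rightarrow> 'f" where
  "Q1 g a c = Q (\<lambda>j. g (a + j) c)"

definition N1 :: "(nat \<Rightarrow> nat \<Rightarrow> 'f) \<Rightarrow> nat \<Rightarrow> nat \<Rightarrow> 'f" where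
  "N1 g a c = of_nat a * (b * g a c)"

text \<open>The term \<open>w / (z - w) (1 - s)\<close> of \<open>D1\<close>, minus what \<open>Q1\<close> and \<open>N1\<close> already count for \<open>x\<^sub>2 = w\<close>:
  \<open>z\<^sup>m w\<^sup>n \<mapsto> w\<^sup>m\<^sup>+\<^sup>1 (w\<^sup>n - z\<^sup>n) / (z - w)\<close>.\<close>

definition K1 :: "(nat \<Rightarrow> nat \<Rightarrow> 'f) \<Rightarrow> nat \<Rightarrow> nat \<Rightarrow> 'f" where
  "K1 g a c = - (\<Sum>m<c. g m (a + c - m))"

definition D1 :: "(nat \<Rightarrow> nat \<Rightarrow> 'f) \<Rightarrow> nat \<Rightarrow> nat \<Rightarrow> 'f" where
  "D1 g a c = E1 g a c + Q1 g a c + N1 g a c + K1 g a c"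

definition swap :: "(nat \<Rightarrow> nat \<Rightarrow> 'f) \<Rightarrow> nat \<Rightarrow> nat \<Rightarrow> 'f" where
  "swap g a c = g c a"

definition D2 :: "(nat \<Rightarrow> nat \<Rightarrow> 'f) \<Rightarrow> nat \<Rightarrow> nat \<Rightarrow> 'f" where
  "D2 g = swap (D1 (swap g))"

abbreviation E2 where "E2 g \<equiv> swap (E1 (swap g))"
abbreviation Q2 where "Q2 g \<equiv> swap (Q1 (swap g))"
abbreviation N2 where "N2 g \<equiv> swap (N1 (swap g))"
abbreviation K2 where "K2 g \<equiv> swap (K1 (swap g))"

lemma swap_swap [simp]: "swap (swap g) = g"
  by (auto simp: swap_def fun_eq_iff)

section \<open>The commutator of \<open>D1\<close> and \<open>D2\<close>\<close>

lemma E1_commute: "E1 (E2 g) = E2 (E1 g)"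
proof (intro ext)
  fix a c
  have "E1 (E2 g) a c = (\<Sum>i=1..a. \<Sum>j=1..c. E j (E i (g (a - i) (c - j))))"
    unfolding E1_def swap_def E_sum by (intro sum.cong refl E_commute)
  also have "\<dots> = E2 (E1 g) a c"
    unfolding E1_def swap_def E_sum by (rule sum.swap)
  finally show "E1 (E2 g) a c = E2 (E1 g) a c" .
qed

lemma E1_upto: "a \<le> n \<Longrightarrow> E1 g a c = (\<Sum>i=1..n. if i \<le> a then E i (g (a - i) c) else 0)"
  unfolding E1_def by (rule sum.mono_neutral_cong_left) auto

text \<open>Among pairs of an \<open>E\<close>, \<open>Q\<close> or \<open>N\<close> part in z with
  one in w, only this one and its mirror image fail to commute; the defect is the Heisenberg term of
  \<open>E_Q\<close>.\<close>

lemma E1_Q2: "E1 (Q2 g) a c = Q2 (E1 g) a c + (\<Sum>i=1..a. of_nat i * (1 + b) * g (a - i) (c + i))"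
  unfolding E1_def Q1_def swap_def Q_sum sum.distrib[symmetric]
  by (rule sum.cong) (auto simp: E_Q)

lemma Q1_Q2: "Q1 (Q2 g) = Q2 (Q1 g)"
  by (auto simp: fun_eq_iff Q1_def swap_def intro: Q_commute)

lemma N1_E2: "N1 (E2 g) = E2 (N1 g)"
  by (auto simp: fun_eq_iff N1_def E1_def swap_def sum_distrib_left E_of_nat E_scale b_S)

lemma N1_Q2: "N1 (Q2 g) = Q2 (N1 g)"
  by (auto simp: fun_eq_iff N1_def Q1_def swap_def Q_of_nat Q_scale b_S)

lemma N1_N2: "N1 (N2 g) = N2 (N1 g)"
  by (auto simp: fun_eq_iff N1_def swap_def algebra_simps)

text \<open>The terms of the commutator with exactly one \<open>E\<close>. For fixed
  \<open>i\<close> all sums run over the values \<open>E i (g m (a + c - i - m))\<close>; either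
  side gives each of them weight -1, plus 1 if \<open>m = c\<close>.\<close>

lemma E_K_exchange: "E1 (K2 g) a c + K1 (E2 g) a c = K2 (E1 g) a c + E2 (K1 g) a c + (E1 (swap g) a c - E2 (swap g) a c)"
proof -
  let ?d = "a + c"
  define e where "e i m = E i (g m (?d - i - m))" for i m
  have 1: "E1 (K2 g) a c = (\<Sum>i=1..?d. if i \<le> a then - (\<Sum>n<a - i. e i (?d - i - n)) else 0)"
    unfolding E1_upto[of a ?d, simplified]
    by (rule sum.cong) (auto simp: swap_def K1_def E_minus E_sum e_def intro!: sum.cong arg_cong2[where f=E] arg_cong2[where f=g])
  have 2: "E2 (K1 g) a c = (\<Sum>i=1..?d. if i \<le> c then - (\<Sum>m<c - i. e i m) else 0)"
    unfolding swap_def E1_upto[of c ?d, simplified]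
    by (rule sum.cong) (auto simp: K1_def E_minus E_sum e_def intro!: sum.cong arg_cong2[where f=E] arg_cong2[where f=g])
  have 3: "K2 (E1 g) a c = (\<Sum>i=1..?d. - (\<Sum>n<a. if i \<le> ?d - n then e i (?d - i - n) else 0))"
    unfolding swap_def K1_def
    apply (subst E1_upto[where n = ?d])
     apply simp
    apply (subst sum.swap)
    apply (auto simp: sum_negf e_def intro!: sum.cong arg_cong2[where f=E] arg_cong2[where f=g])
    done
  have 4: "K1 (E2 g) a c = (\<Sum>i=1..?d. - (\<Sum>m<c. if i \<le> ?d - m then e i m else 0))"
    unfolding swap_def K1_def
    apply (subst E1_upto[where n = ?d])
     apply simp
    apply (subst sum.swap)
    apply (auto simp: sum_negf e_def intro!: sum.cong arg_cong2[where f=E] arg_cong2[where f=g])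
    done
  have 5: "E1 (swap g) a c = (\<Sum>i=1..?d. if i \<le> a then e i c else 0)"
    unfolding E1_upto[of a ?d, simplified]
    by (rule sum.cong) (auto simp: swap_def e_def intro!: arg_cong2[where f=E] arg_cong2[where f=g])
  have 6: "E2 (swap g) a c = (\<Sum>i=1..?d. if i \<le> c then e i (c - i) else 0)"
    unfolding swap_def E1_upto[of c ?d, simplified]
    by (rule sum.cong) (auto simp: e_def intro!: arg_cong2[where f=E] arg_cong2[where f=g])
  have "(if i \<le> a then - (\<Sum>n<a - i. e i (?d - i - n)) else 0) + (- (\<Sum>m<c. if i \<le> ?d - m then e i m else 0))
      = (- (\<Sum>n<a. if i \<le> ?d - n then e i (?d - i - n) else 0)) + (if i \<le> c then - (\<Sum>m<c - i. e i m) else 0)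
        + ((if i \<le> a then e i c else 0) - (if i \<le> c then e i (c - i) else 0))"
    if i: "1 \<le> i" "i \<le> ?d" for i
  proof -
    let ?N = "?d - i"
    have a: "(if i \<le> a then (\<Sum>n<a - i. e i (?N - n)) else 0) = (\<Sum>m\<le>?N. if c < m then e i m else 0)"
    proof (cases "i \<le> a")
      case True
      then have "(\<Sum>n<a - i. e i (?N - n)) = (\<Sum>m\<le>?N. if ?N < m + (a - i) then e i m else 0)"
        by (intro sum_reflect_le) auto
      also have "\<dots> = (\<Sum>m\<le>?N. if c < m then e i m else 0)"
        using True by (intro sum.cong) auto
      finally show ?thesis using True by simp
    qed (auto intro!: sum.neutral)
    have "(\<Sum>n<a. if i \<le> ?d - n then e i (?N - n) else 0) = (\<Sum>n\<in>{n\<in>{..<a}. i \<le> ?d - n}. e i (?N - n))"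
      by (rule sum.inter_filter[symmetric]) simp
    \<comment> \<open>Once \<open>i > c + 1\<close>, the bound \<open>a\<close> exceeds
      \<open>Suc ?N\<close>; hence the minimum.\<close>
    also have "{n\<in>{..<a}. i \<le> ?d - n} = {..<min a (Suc ?N)}"
      using i by auto
    also have "(\<Sum>n\<in>\<dots>. e i (?N - n)) = (\<Sum>m\<le>?N. if c < m + i then e i m else 0)"
      using i by (subst sum_reflect_le) (auto intro!: sum.cong)
    finally have bb: "(\<Sum>n<a. if i \<le> ?d - n then e i (?N - n) else 0) = (\<Sum>m\<le>?N. if c < m + i then e i m else 0)" .
    have "(\<Sum>m<c. if i \<le> ?d - m then e i m else 0) = (\<Sum>n\<in>{n\<in>{..<c}. i \<le> ?d - n}. e i n)"
      by (rule sum.inter_filter[symmetric]) simp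
    also have "{n\<in>{..<c}. i \<le> ?d - n} = {..<min c (Suc ?N)}"
      using i by auto
    also have "(\<Sum>n\<in>\<dots>. e i n) = (\<Sum>m\<le>?N. if m < c then e i m else 0)"
      using i by (subst sum_lessThan_le) (auto intro!: sum.cong)
    finally have cc: "(\<Sum>m<c. if i \<le> ?d - m then e i m else 0) = (\<Sum>m\<le>?N. if m < c then e i m else 0)" .
    have dd: "(if i \<le> c then (\<Sum>m<c - i. e i m) else 0) = (\<Sum>m\<le>?N. if m + i < c then e i m else 0)"
      using i by (auto simp: sum_lessThan_le[of _ ?N] intro!: sum.cong)
    have ee: "(if i \<le> a then e i c else 0) = (\<Sum>m\<le>?N. if m = c then e i m else 0)"
      using i by auto
    have ff: "(if i \<le> c then e i (c - i) else 0) = (\<Sum>m\<le>?N. if m + i = c then e i m else 0)"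
    proof (cases "i \<le> c")
      case True
      have "e i (c - i) = (\<Sum>m\<le>?N. if m = c - i then e i m else 0)"
        by (rule single_term_le) (use True in auto)
      also have "\<dots> = (\<Sum>m\<le>?N. if m + i = c then e i m else 0)"
        using True by (intro sum.cong) auto
      finally show ?thesis using True by simp
    qed auto
    have neg: "(if P then - x else 0) = - (if P then x else 0)" for P and x :: 'f by simp
    show ?thesis
      unfolding neg a bb cc dd ee ff
      unfolding sum_negf[symmetric] sum_subtractf[symmetric] sum.distrib[symmetric]
      by (rule sum.cong) (use i in auto)
  qed
  then show ?thesis
    unfolding 1 2 3 4 5 6 sum_subtractf[symmetric] sum.distrib[symmetric]
    by (intro sum.cong) auto
qed

text \<open>The terms with exactly one \<open>Q\<close>. The total degree read from \<open>g\<close>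
  is now \<open>a + c + j\<close>; for fixed \<open>j\<close> the weights are again -1, plus 1 if
  \<open>m = c\<close>.\<close>

lemma Q_K_exchange: "Q1 (K2 g) a c + K1 (Q2 g) a c = K2 (Q1 g) a c + Q2 (K1 g) a c + (Q1 (swap g) a c - Q2 (swap g) a c)"
proof -
  define e where "e j m = g m (a + c + j - m)" for j m
  have 1: "Q1 (K2 g) a c = Q (\<lambda>j. - (\<Sum>n<a + j. e j (a + c + j - n)))"
    unfolding Q1_def swap_def K1_def e_def
    by (rule Q_cong) (auto intro!: sum.cong arg_cong2[where f=g])
  have 2: "Q2 (K1 g) a c = Q (\<lambda>j. - (\<Sum>m<c + j. e j m))"
    unfolding Q1_def swap_def K1_def e_def
    by (rule Q_cong) (auto intro!: sum.cong arg_cong2[where f=g])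
  have 3: "K2 (Q1 g) a c = Q (\<lambda>j. - (\<Sum>n<a. e j (a + c + j - n)))"
    unfolding Q1_def swap_def K1_def e_def Q_minus Q_sum
    by (auto intro!: sum.cong Q_cong arg_cong2[where f=g])
  have 4: "K1 (Q2 g) a c = Q (\<lambda>j. - (\<Sum>m<c. e j m))"
    unfolding Q1_def swap_def K1_def e_def Q_minus Q_sum
    by (auto intro!: sum.cong Q_cong arg_cong2[where f=g])
  have 5: "Q1 (swap g) a c = Q (\<lambda>j. e j c)"
    unfolding Q1_def swap_def e_def
    by (rule Q_cong) (auto intro!: arg_cong2[where f=g])
  have 6: "Q2 (swap g) a c = Q (\<lambda>j. e j (c + j))"
    unfolding Q1_def swap_def e_def
    by (rule Q_cong) (auto intro!: arg_cong2[where f=g])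
  have "- (\<Sum>n<a + j. e j (a + c + j - n)) + - (\<Sum>m<c. e j m)
      = - (\<Sum>n<a. e j (a + c + j - n)) + - (\<Sum>m<c + j. e j m) + (e j c - e j (c + j))"
    if "1 \<le> j" for j
  proof -
    let ?N = "a + c + j"
    have a: "(\<Sum>n<a + j. e j (?N - n)) = (\<Sum>m\<le>?N. if ?N < m + (a + j) then e j m else 0)"
      by (rule sum_reflect_le) simp
    have bb: "(\<Sum>n<a. e j (?N - n)) = (\<Sum>m\<le>?N. if ?N < m + a then e j m else 0)"
      by (rule sum_reflect_le) simp
    have cc: "(\<Sum>m<c. e j m) = (\<Sum>m\<le>?N. if m < c then e j m else 0)"
      by (rule sum_lessThan_le) simp
    have dd: "(\<Sum>m<c + j. e j m) = (\<Sum>m\<le>?N. if m < c + j then e j m else 0)"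
      by (rule sum_lessThan_le) simp
    have ee: "e j c = (\<Sum>m\<le>?N. if m = c then e j m else 0)"
      by (rule single_term_le) simp
    have ff: "e j (c + j) = (\<Sum>m\<le>?N. if m = c + j then e j m else 0)"
      by (rule single_term_le) simp
    show ?thesis
      apply (subst a, subst bb, subst cc, subst dd, subst ee, subst ff)
      unfolding sum_negf[symmetric] sum_subtractf[symmetric] sum.distrib[symmetric]
      by (rule sum.cong) (use that in auto)
  qed
  then show ?thesis
    unfolding 1 2 3 4 5 6 Q_diff[symmetric] Q_add[symmetric]
    by (intro Q_cong) auto
qed

text \<open>The terms preserving total degree. The first two sums are the defects of
  \<open>E1_Q2\<close> and \<open>Q1_E2\<close>: their unit part balances the compositions of
  \<open>K1\<close> and \<open>K2\<close> and the terms \<open>K1 (swap g)\<close>,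
  \<open>K2 (swap g)\<close>, their \<open>b\<close> part the terms with \<open>N1\<close> and
  \<open>N2\<close>.\<close>

lemma N_K_exchange: "(\<Sum>i=1..a. of_nat i * (1 + b) * g (a - i) (c + i)) - (\<Sum>i=1..c. of_nat i * (1 + b) * g (a + i) (c - i))
    + N1 (K2 g) a c + K1 (N2 g) a c + K1 (K2 g) a c
    = K2 (N1 g) a c + N2 (K1 g) a c + K2 (K1 g) a c + (N1 (swap g) a c - N2 (swap g) a c)
      + (K1 (swap g) a c - K2 (swap g) a c)"
proof -
  let ?d = "a + c"
  define h where "h m = g m (?d - m)" for m
  have 1: "(\<Sum>i=1..a. of_nat i * (1 + b) * g (a - i) (c + i)) = (\<Sum>m\<le>?d. if m < a then of_nat (a - m) * (1 + b) * h m else 0)"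
  proof -
    have "(\<Sum>i=1..a. of_nat i * (1 + b) * g (a - i) (c + i)) = (\<Sum>m\<in>{m\<in>{..?d}. m < a}. of_nat (a - m) * (1 + b) * h m)"
      by (rule sum.reindex_bij_witness[where i="\<lambda>m. a - m" and j="\<lambda>i. a - i"])
        (auto simp: h_def intro!: arg_cong2[where f=g])
    then show ?thesis unfolding sum.inter_filter[OF finite_atMost] .
  qed
  have 2: "(\<Sum>i=1..c. of_nat i * (1 + b) * g (a + i) (c - i)) = (\<Sum>m\<le>?d. if a < m then of_nat (m - a) * (1 + b) * h m else 0)"
  proof -
    have "(\<Sum>i=1..c. of_nat i * (1 + b) * g (a + i) (c - i)) = (\<Sum>m\<in>{m\<in>{..?d}. a < m}. of_nat (m - a) * (1 + b) * h m)"
      by (rule sum.reindex_bij_witness[where i="\<lambda>m. m - a" and j="\<lambda>i. a + i"])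
        (auto simp: h_def intro!: arg_cong2[where f=g])
    then show ?thesis unfolding sum.inter_filter[OF finite_atMost] .
  qed
  \<comment> \<open>Four reindexings for the sums in \<open>K1\<close> and \<open>K2\<close>, the
    primed ones for compositions and \<open>swap\<close>; \<open>f\<close> carries a weight
    depending on the index.\<close>
  have K2: "(\<Sum>n<a. f (g (?d - n) n) n) = (\<Sum>m\<le>?d. if c < m then f (h m) (?d - m) else 0)" for f :: "'f \<Rightarrow> nat \<Rightarrow> 'f"
  proof -
    have "(\<Sum>n<a. f (g (?d - n) n) n) = (\<Sum>m\<in>{m\<in>{..?d}. c < m}. f (h m) (?d - m))"
      by (rule sum.reindex_bij_witness[where i="\<lambda>m. ?d - m" and j="\<lambda>n. ?d - n"])
        (auto simp: h_def)
    then show ?thesis unfolding sum.inter_filter[OF finite_atMost] .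
  qed
  have K1: "(\<Sum>m<c. f (g m (?d - m)) m) = (\<Sum>m\<le>?d. if m < c then f (h m) m else 0)" for f :: "'f \<Rightarrow> nat \<Rightarrow> 'f"
    unfolding h_def by (rule sum_lessThan_le) simp
  have K2': "(\<Sum>n<a. f (g n (?d - n)) n) = (\<Sum>m\<le>?d. if m < a then f (h m) m else 0)" for f :: "'f \<Rightarrow> nat \<Rightarrow> 'f"
    unfolding h_def by (rule sum_lessThan_le) simp
  have K1': "(\<Sum>m<c. f (g (?d - m) m) m) = (\<Sum>m\<le>?d. if a < m then f (h m) (?d - m) else 0)" for f :: "'f \<Rightarrow> nat \<Rightarrow> 'f"
  proof -
    have "(\<Sum>n<c. f (g (?d - n) n) n) = (\<Sum>m\<in>{m\<in>{..?d}. a < m}. f (h m) (?d - m))"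
      by (rule sum.reindex_bij_witness[where i="\<lambda>m. ?d - m" and j="\<lambda>n. ?d - n"])
        (auto simp: h_def)
    then show ?thesis unfolding sum.inter_filter[OF finite_atMost] .
  qed
  have 3: "N1 (K2 g) a c = (\<Sum>m\<le>?d. if c < m then - (of_nat a * (b * h m)) else 0)"
    using K2[of "\<lambda>x n. - (of_nat a * (b * x))"]
    by (simp add: N1_def K1_def swap_def sum_distrib_left sum_negf add.commute)
  have 4: "N2 (K1 g) a c = (\<Sum>m\<le>?d. if m < c then - (of_nat c * (b * h m)) else 0)"
    using K1[of "\<lambda>x n. - (of_nat c * (b * x))"]
    by (simp add: N1_def K1_def swap_def sum_distrib_left sum_negf)
  have 5: "K1 (N2 g) a c = (\<Sum>m\<le>?d. if m < c then - (of_nat (?d - m) * (b * h m)) else 0)"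
    using K1[of "\<lambda>x n. - (of_nat (?d - n) * (b * x))"]
    by (simp add: N1_def K1_def swap_def sum_negf)
  have 6: "K2 (N1 g) a c = (\<Sum>m\<le>?d. if c < m then - (of_nat m * (b * h m)) else 0)"
    using K2[of "\<lambda>x n. - (of_nat (?d - n) * (b * x))"]
    by (simp add: N1_def K1_def swap_def sum_negf add.commute cong: if_cong)
  have 7: "K1 (K2 g) a c = (\<Sum>m\<le>?d. if a < m then of_nat (c - 1 - (?d - m)) * h m else 0)"
  proof -
    have "K1 (K2 g) a c = (\<Sum>m<c. \<Sum>n<m. g (?d - n) n)"
      unfolding K1_def swap_def sum_negf[symmetric] by (intro sum.cong) auto
    then show ?thesis
      using K1'[of "\<lambda>x n. of_nat (c - 1 - n) * x"] by (simp add: sum_lessThan_lessThan)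
  qed
  have 8: "K2 (K1 g) a c = (\<Sum>m\<le>?d. if m < a then of_nat (a - 1 - m) * h m else 0)"
  proof -
    have "K2 (K1 g) a c = (\<Sum>m<a. \<Sum>n<m. g n (?d - n))"
      unfolding K1_def swap_def sum_negf[symmetric] by (intro sum.cong) (auto simp: add.commute)
    then show ?thesis
      using K2'[of "\<lambda>x n. of_nat (a - 1 - n) * x"] by (simp add: sum_lessThan_lessThan)
  qed
  have 9: "N1 (swap g) a c = (\<Sum>m\<le>?d. if m = c then of_nat a * (b * h m) else 0)"
    by (simp add: N1_def swap_def h_def)
  have 10: "N2 (swap g) a c = (\<Sum>m\<le>?d. if m = c then of_nat c * (b * h m) else 0)"
    by (simp add: N1_def swap_def h_def)
  have 11: "K1 (swap g) a c = (\<Sum>m\<le>?d. if a < m then - h m else 0)"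
    using K1'[of "\<lambda>x n. - x"] by (simp add: K1_def swap_def sum_negf)
  have 12: "K2 (swap g) a c = (\<Sum>m\<le>?d. if m < a then - h m else 0)"
    using K2'[of "\<lambda>x n. - x"] by (simp add: K1_def swap_def sum_negf add.commute)
  show ?thesis
    unfolding 1 2 3 4 5 6 7 8 9 10 11 12 sum_subtractf[symmetric] sum.distrib[symmetric]
  proof (rule sum.cong[OF refl], goal_cases)
    case (1 m)
    \<comment> \<open>Since \<open>a - m = n - c\<close> as integers, naming this difference
      \<open>Suc q\<close>, zero or minus \<open>Suc q\<close> removes the truncated
      subtractions.\<close>
    then obtain n where n: "?d = m + n"
      using le_Suc_ex by auto
    consider q where "a = m + Suc q" "n = c + Suc q" | "a = m" "n = c" | q where "m = a + Suc q" "c = n + Suc q"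
      using n less_imp_Suc_add by (cases m a rule: linorder_cases) fastforce+
    then show ?case
    proof cases
      case 1
      then show ?thesis
        unfolding n by (cases m c rule: linorder_cases) (simp_all add: algebra_simps)
    next
      case 2
      then show ?thesis
        unfolding n by (cases m c rule: linorder_cases) (simp_all add: algebra_simps)
    next
      case 3
      then show ?thesis
        unfolding n by (cases m c rule: linorder_cases) (simp_all add: algebra_simps)
    qed
  qed
qed

lemma E_diff: "E i (f - g) = E i f - E i g"
  using E_add[of i "f - g" g] by simp

lemma swap_add [simp]: "swap (g + h) = swap g + swap h"
  and swap_diff [simp]: "swap (g - h) = swap g - swap h"
  by (auto simp: swap_def fun_eq_iff)

lemma E1_add: "E1 (g + h) = E1 g + E1 h"
  by (auto simp: fun_eq_iff E1_def E_add sum.distrib)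

lemma Q1_add: "Q1 (g + h) = Q1 g + Q1 h"
  by (auto simp: fun_eq_iff Q1_def Q_add)

lemma N1_add: "N1 (g + h) = N1 g + N1 h"
  by (auto simp: fun_eq_iff N1_def algebra_simps)

lemma K1_add: "K1 (g + h) = K1 g + K1 h"
  by (auto simp: fun_eq_iff K1_def sum.distrib)

lemma D1_eq: "D1 g = E1 g + Q1 g + N1 g + K1 g"
  by (auto simp: fun_eq_iff D1_def)

lemma D2_eq: "D2 g = E2 g + Q2 g + N2 g + K2 g"
  by (simp add: D2_def D1_eq)

lemma D1_add: "D1 (g + h) = D1 g + D1 h"
  by (simp add: D1_eq E1_add Q1_add N1_add K1_add)

lemma D2_add: "D2 (g + h) = D2 g + D2 h"
  by (simp add: D2_def D1_add)

lemma D2_diff: "D2 (g - h) = D2 g - D2 h"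
  using D2_add[of "g - h" h] by simp

lemma Q1_E2: "Q1 (E2 g) a c = E2 (Q1 g) a c - (\<Sum>i=1..c. of_nat i * (1 + b) * g (a + i) (c - i))"
  using E1_Q2[of "swap g" c a] by (simp add: swap_def)

lemma E1_N2: "E1 (N2 g) = N2 (E1 g)"
  using N1_E2[of "swap g"] by (metis swap_swap)

lemma Q1_N2: "Q1 (N2 g) = N2 (Q1 g)"
  using N1_Q2[of "swap g"] by (metis swap_swap)

text \<open>The sum of the three exchange identities; the other pairs of parts commute.\<close>

lemma D_commutator: "D1 (D2 g) = D2 (D1 g) + D1 (swap g) - D2 (swap g)"
proof (intro ext)
  fix a c
  show "D1 (D2 g) a c = (D2 (D1 g) + D1 (swap g) - D2 (swap g)) a c"
    using arg_cong2[where f="(+)", OF arg_cong2[where f="(+)", OF E_K_exchange[of g a c] Q_K_exchange[of g a c]] N_K_exchange[of g a c]]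
    by (simp add: D1_eq D2_eq E1_add Q1_add N1_add K1_add E1_commute E1_Q2 Q1_E2 Q1_Q2 N1_E2 N1_Q2 N1_N2 E1_N2 Q1_N2
       algebra_simps)
qed

lemma swap_D1: "swap (D1 g) = D2 (swap g)" and swap_D2: "swap (D2 g) = D1 (swap g)"
  by (simp_all add: D2_def)

section \<open>Shifts, inclusions and the sum over the second variable\<close>

definition shift :: "(nat \<Rightarrow> 'f) \<Rightarrow> nat \<Rightarrow> 'f" where
  "shift g a = (if a = 0 then 0 else g (a - 1))"

definition shift1 :: "(nat \<Rightarrow> nat \<Rightarrow> 'f) \<Rightarrow> nat \<Rightarrow> nat \<Rightarrow> 'f" where
  "shift1 g a c = (if a = 0 then 0 else g (a - 1) c)"

definition shift2 :: "(nat \<Rightarrow> nat \<Rightarrow> 'f) \<Rightarrow> nat \<Rightarrow> nat \<Rightarrow> 'f" where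
  "shift2 g a c = (if c = 0 then 0 else g a (c - 1))"

definition \<iota> :: "(nat \<Rightarrow> 'f) \<Rightarrow> nat \<Rightarrow> nat \<Rightarrow> 'f" where
  "\<iota> g a c = (if c = 0 then g a else 0)"

definition emb :: "'f \<Rightarrow> nat \<Rightarrow> 'f" where
  "emb f a = (if a = 0 then f else 0)"

text \<open>\<open>\<Sum>j \<ge> 2. g (x\<^sub>1, x\<^sub>j)\<close>, that is \<open>w\<^sup>n \<mapsto> p\<^sub>n - z\<^sup>n\<close>; for \<open>n = 0\<close> it maps \<open>1\<close> to \<open>- 1\<close>.\<close>

definition \<Theta> :: "(nat \<Rightarrow> nat \<Rightarrow> 'f) \<Rightarrow> nat \<Rightarrow> 'f" where
  "\<Theta> g a = Q (g a) - (\<Sum>j\<le>a. g (a - j) j)"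

lemma shift_add: "shift (g + h) = shift g + shift h"
  by (auto simp: shift_def fun_eq_iff)

lemma shift1_add: "shift1 (g + h) = shift1 g + shift1 h"
  by (auto simp: shift1_def fun_eq_iff)

lemma shift2_add: "shift2 (g + h) = shift2 g + shift2 h"
  by (auto simp: shift2_def fun_eq_iff)

lemma Q_plus: "Q (g + h) = Q g + Q h"
  using Q_add[of g h] by (simp add: plus_fun_def)

lemma \<Theta>_add: "\<Theta> (g + h) = \<Theta> g + \<Theta> h"
  by (auto simp: \<Theta>_def fun_eq_iff Q_plus sum.distrib algebra_simps)

lemma \<Theta>_diff: "\<Theta> (g - h) = \<Theta> g - \<Theta> h"
  using \<Theta>_add[of "g - h" h] by simp

lemma \<Lambda>_add: "\<Lambda> (g + h) = \<Lambda> g + \<Lambda> h"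
  by (auto simp: \<Lambda>_def fun_eq_iff E_add Q_add sum.distrib algebra_simps)

lemma shift1_shift2: "shift1 (shift2 g) = shift2 (shift1 g)"
  by (auto simp: shift1_def shift2_def fun_eq_iff)

lemma swap_shift1: "swap (shift1 g) = shift2 (swap g)" and swap_shift2: "swap (shift2 g) = shift1 (swap g)"
  by (auto simp: shift1_def shift2_def swap_def fun_eq_iff)

lemma \<iota>_shift: "\<iota> (shift g) = shift1 (\<iota> g)"
  by (auto simp: \<iota>_def shift_def shift1_def fun_eq_iff)

text \<open>\<open>K1\<close> kills functions free of w, because \<open>w^n - z^n\<close> vanishes
  for \<open>n = 0\<close>.\<close>

lemma \<iota>_\<Lambda>: "\<iota> (\<Lambda> g) = D1 (\<iota> g)"
  by (auto simp: \<iota>_def \<Lambda>_def D1_def E1_def Q1_def N1_def K1_def fun_eq_iff intro!: sum.neutral)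

lemma swap_\<iota>_emb: "swap (\<iota> (emb f)) = \<iota> (emb f)"
  by (auto simp: swap_def \<iota>_def emb_def fun_eq_iff)

lemma shift_\<Theta>: "shift (\<Theta> g) = \<Theta> (shift1 g)"
proof (intro ext)
  fix a
  show "shift (\<Theta> g) a = \<Theta> (shift1 g) a"
  proof (cases a)
    case (Suc m)
    have "(\<Sum>j\<le>Suc m. shift1 g (Suc m - j) j) = (\<Sum>j\<le>m. g (m - j) j)"
      by (auto simp: shift1_def Suc_diff_le intro!: sum.cong)
    moreover have "shift1 g (Suc m) = g m"
      by (auto simp: shift1_def fun_eq_iff)
    ultimately show ?thesis
      by (simp add: shift_def \<Theta>_def Suc)
  next
    case 0
    have "shift1 g 0 = (\<lambda>_. 0)"
      by (auto simp: shift1_def fun_eq_iff)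
    then show ?thesis
      by (simp add: 0 shift_def \<Theta>_def shift1_def)
  qed
qed

text \<open>Formally a sum over ordered pairs of distinct variables, hence symmetric.\<close>

lemma Q_\<Theta>_swap: "Q (\<Theta> (swap g)) = Q (\<Theta> g)"
proof -
  have "(\<Sum>j\<le>a. swap g (a - j) j) = (\<Sum>j\<le>a. g (a - j) j)" for a
    by (rule sum.reindex_bij_witness[where i="\<lambda>j. a - j" and j="\<lambda>j. a - j"]) (auto simp: swap_def)
  then show ?thesis
    unfolding \<Theta>_def Q_diff by (subst Q_commute) (simp add: swap_def)
qed

text \<open>Splits a sum over all variables into the term of the first one and the rest. The
  convention of \<open>\<Theta>\<close> in degree 0 makes the constant term \<open>g 0\<close>
  cancel.\<close>

lemma emb_Q: "emb (Q g) = g + \<Theta> (swap (\<iota> g))"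
proof (intro ext)
  fix a
  have "(\<Sum>j\<le>a. swap (\<iota> g) (a - j) j) = (\<Sum>j\<le>a. if j = a then g j else 0)"
    by (rule sum.cong) (auto simp: swap_def \<iota>_def)
  moreover have "swap (\<iota> g) a = (if a = 0 then g else (\<lambda>_. 0))"
    by (auto simp: swap_def \<iota>_def fun_eq_iff)
  ultimately show "emb (Q g) a = (g + \<Theta> (swap (\<iota> g))) a"
    by (simp add: emb_def \<Theta>_def)
qed

text \<open>Only \<open>K1\<close> sees the exponent of w: its sum up to \<open>c\<close> has one
  term more than the sum up to \<open>c - 1\<close>, and that term is the value of
  \<open>swap g\<close>.\<close>

lemma D1_shift2: "D1 (shift2 g) = shift2 (D1 g - swap g)"
proof (intro ext)
  fix a c
  show "D1 (shift2 g) a c = shift2 (D1 g - swap g) a c"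
  proof (cases c)
    case (Suc m)
    have "(\<Sum>i<m. if a + c - i = 0 then 0 else g i (a + c - i - 1)) = (\<Sum>i<m. g i (a + m - i))"
      using Suc by (intro sum.cong) (auto simp: Suc_diff_le)
    then show ?thesis
      by (simp add: shift2_def D1_def E1_def Q1_def N1_def K1_def swap_def Suc)
  qed (simp add: shift2_def D1_def E1_def Q1_def N1_def K1_def)
qed

text \<open>The last summand is \<open>emb (Q (shift g)) - shift g\<close>. Its negative part
  cancels the 1 in \<open>1 + b\<close>, the \<open>b\<close> comes from the factor
  \<open>of_nat a * b\<close>, and \<open>Q (shift g)\<close> is what survives at index 0.\<close>

lemma \<Lambda>_shift: "\<Lambda> (shift g) = shift (\<Lambda> g) + (\<lambda>a. (1 + b) * shift g a) + \<Theta> (shift2 (swap (\<iota> g)))"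
proof (intro ext)
  fix a
  have 1: "(\<Sum>j\<le>a. shift2 (swap (\<iota> g)) (a - j) j) = (\<Sum>j\<le>a. if j = a then shift g j else 0)"
    by (rule sum.cong) (auto simp: swap_def \<iota>_def shift2_def shift_def)
  have 2: "Q (shift2 (swap (\<iota> g)) a) = (if a = 0 then Q (shift g) else 0)"
  proof -
    have "shift2 (swap (\<iota> g)) a = (if a = 0 then shift g else (\<lambda>_. 0))"
      by (auto simp: swap_def \<iota>_def shift2_def shift_def fun_eq_iff)
    then show ?thesis by simp
  qed
  show "\<Lambda> (shift g) a = (shift (\<Lambda> g) + (\<lambda>a. (1 + b) * shift g a) + \<Theta> (shift2 (swap (\<iota> g)))) a"
  proof (cases a)
    case (Suc m)
    have "(\<Sum>i=1..Suc m. E i (shift g (Suc m - i))) = (\<Sum>i=1..m. E i (g (m - i)))"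
      by (auto simp: shift_def Suc_diff_le intro!: sum.cong)
    then show ?thesis
      unfolding \<Theta>_def plus_fun_apply 1 2 using Suc by (simp add: shift_def \<Lambda>_def algebra_simps)
  next
    case 0
    then show ?thesis
      unfolding \<Theta>_def plus_fun_apply 1 2 by (simp add: shift_def[abs_def] \<Lambda>_def cong: if_cong)
  qed
qed

text \<open>\<open>D1\<close> is \<open>\<Lambda>\<close> applied under the sum over the other
  variables. The Heisenberg terms \<open>of_nat i * (1 + b) * g (a - i) i\<close> balance: their
  unit part is the diagonal sum of \<open>K1\<close>, their \<open>b\<close> part offsets the degree
  in w that \<open>N1\<close> leaves out.\<close>

lemma \<Lambda>_\<Theta>: "\<Lambda> (\<Theta> g) = \<Theta> (D1 g)"
proof (intro ext)
  fix a
  have E: "(\<Sum>i=1..a. E i (\<Theta> g (a - i))) = Q (\<lambda>j. E1 g a j) + (\<Sum>i\<le>a. of_nat i * ((1 + b) * g (a - i) i))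
      - (\<Sum>j\<le>a. E1 g (a - j) j)"
  proof -
    have "(\<Sum>i=1..a. E i (\<Theta> g (a - i)))
        = (\<Sum>i=1..a. Q (\<lambda>j. E i (g (a - i) j))) + (\<Sum>i=1..a. of_nat i * ((1 + b) * g (a - i) i))
          - (\<Sum>i=1..a. \<Sum>j\<le>a - i. E i (g (a - i - j) j))"
      unfolding sum.distrib[symmetric] sum_subtractf[symmetric]
      by (rule sum.cong) (auto simp: \<Theta>_def E_Q E_sum E_diff algebra_simps)
    moreover have "(\<Sum>i=1..a. of_nat i * ((1 + b) * g (a - i) i)) = (\<Sum>i\<le>a. of_nat i * ((1 + b) * g (a - i) i))"
      by (rule sum.mono_neutral_left) (auto simp: Suc_le_eq)
    moreover have "(\<Sum>i=1..a. \<Sum>j\<le>a - i. E i (g (a - i - j) j)) = (\<Sum>j\<le>a. E1 g (a - j) j)"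
    proof -
      have "(\<Sum>j\<le>a. E1 g (a - j) j) = (\<Sum>j\<le>a. \<Sum>i=1..a. if i \<le> a - j then E i (g (a - j - i) j) else 0)"
        by (rule sum.cong) (auto simp: E1_upto[where n=a])
      also have "\<dots> = (\<Sum>i=1..a. \<Sum>j\<le>a. if i \<le> a - j then E i (g (a - j - i) j) else 0)"
        by (rule sum.swap)
      also have "\<dots> = (\<Sum>i=1..a. \<Sum>j\<le>a - i. E i (g (a - i - j) j))"
        by (intro sum.cong refl sum.mono_neutral_cong_right) (auto simp: add.commute)
      finally show ?thesis by simp
    qed
    ultimately show ?thesis by (simp add: E1_def Q_sum)
  qed
  have Q: "Q (\<lambda>i. \<Theta> g (a + i)) = Q (\<lambda>j. Q1 g a j) - (\<Sum>j\<le>a. Q1 g (a - j) j) + Q (\<lambda>j. K1 g a j)"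
  proof -
    \<comment> \<open>Terms with \<open>j \<le> a\<close> lead to \<open>Q1\<close>; those with
      \<open>j > a\<close> form the sum in \<open>K1\<close>.\<close>
    have "(\<Sum>j\<le>a + i. g (a + i - j) j) = (\<Sum>j\<le>a. g (a - j + i) j) - K1 g a i" for i
    proof -
      have "(\<Sum>j\<le>a + i. g (a + i - j) j) = (\<Sum>j\<le>a. g (a + i - j) j) + (\<Sum>j\<in>{a<..a + i}. g (a + i - j) j)"
        by (subst sum.union_disjoint[symmetric]) (auto intro!: sum.cong)
      moreover have "(\<Sum>j\<in>{a<..a + i}. g (a + i - j) j) = (\<Sum>m<i. g m (a + i - m))"
        by (rule sum.reindex_bij_witness[where i="\<lambda>m. a + i - m" and j="\<lambda>m. a + i - m"]) auto
      ultimately show ?thesis by (simp add: K1_def)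
    qed
    then have "(\<lambda>i. \<Theta> g (a + i)) = (\<lambda>i. Q (g (a + i)) - (\<Sum>j\<le>a. g (a - j + i) j) + K1 g a i)"
      by (simp only: \<Theta>_def diff_diff_eq2 diff_add_eq)
    then have "Q (\<lambda>i. \<Theta> g (a + i)) = Q (\<lambda>i. Q (g (a + i))) - Q (\<lambda>i. \<Sum>j\<le>a. g (a - j + i) j) + Q (\<lambda>i. K1 g a i)"
      by (simp add: Q_diff Q_add)
    then show ?thesis
      unfolding Q_sum Q1_def by (subst Q_commute)
  qed
  have K: "(\<Sum>j\<le>a. K1 g (a - j) j) = - (\<Sum>j\<le>a. of_nat j * g (a - j) j)"
  proof -
    have "(\<Sum>j\<le>a. K1 g (a - j) j) = - (\<Sum>j<Suc a. \<Sum>m<j. g m (a - m))"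
      unfolding K1_def sum_negf lessThan_Suc_atMost by (intro arg_cong[where f=uminus] sum.cong) auto
    also have "\<dots> = - (\<Sum>n<Suc a. of_nat (a - n) * g n (a - n))"
      by (subst sum_lessThan_lessThan) simp
    also have "(\<Sum>n<Suc a. of_nat (a - n) * g n (a - n)) = (\<Sum>j\<le>a. of_nat j * g (a - j) j)"
      by (rule sum.reindex_bij_witness[where i="\<lambda>m. a - m" and j="\<lambda>m. a - m"]) auto
    finally show ?thesis .
  qed
  have N: "of_nat a * (b * \<Theta> g a) = Q (\<lambda>j. N1 g a j) - (\<Sum>j\<le>a. N1 g (a - j) j) - (\<Sum>j\<le>a. of_nat j * (b * g (a - j) j))"
  proof -
    have "(\<Sum>j\<le>a. N1 g (a - j) j) + (\<Sum>j\<le>a. of_nat j * (b * g (a - j) j)) = of_nat a * (b * (\<Sum>j\<le>a. g (a - j) j))"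
      unfolding sum.distrib[symmetric] sum_distrib_left N1_def
      by (rule sum.cong) (auto simp: of_nat_diff algebra_simps)
    then show ?thesis
      by (simp add: \<Theta>_def N1_def Q_of_nat Q_scale b_S algebra_simps)
  qed
  have "\<Lambda> (\<Theta> g) a = (\<Sum>i=1..a. E i (\<Theta> g (a - i))) + Q (\<lambda>i. \<Theta> g (a + i)) + of_nat a * (b * \<Theta> g a)"
    by (simp add: \<Lambda>_def)
  also have "\<dots> = \<Theta> (D1 g) a"
    unfolding E Q N unfolding \<Theta>_def D1_def Q_add sum.distrib K
    by (simp add: algebra_simps sum.distrib)
  finally show "\<Lambda> (\<Theta> g) a = \<Theta> (D1 g) a" .
qed

section \<open>Scalars and the operators \<open>A\<close>, \<open>A1\<close>,
  \<open>A2\<close>\<close>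

definition scale1 :: "'f \<Rightarrow> (nat \<Rightarrow> 'f) \<Rightarrow> nat \<Rightarrow> 'f" where
  "scale1 c g a = c * g a"

definition scale2 :: "'f \<Rightarrow> (nat \<Rightarrow> nat \<Rightarrow> 'f) \<Rightarrow> nat \<Rightarrow> nat \<Rightarrow> 'f" where
  "scale2 c g a d = c * g a d"

lemma scale1_add: "scale1 c (g + h) = scale1 c g + scale1 c h"
  by (auto simp: scale1_def fun_eq_iff algebra_simps)

lemma scale2_add: "scale2 c (g + h) = scale2 c g + scale2 c h"
  by (auto simp: scale2_def fun_eq_iff algebra_simps)

lemma scale2_diff: "scale2 c (g - h) = scale2 c g - scale2 c h"
  by (auto simp: scale2_def fun_eq_iff algebra_simps)

lemma scale2_commute: "scale2 c (scale2 d g) = scale2 d (scale2 c g)"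
  by (auto simp: scale2_def fun_eq_iff algebra_simps)

lemma swap_scale2: "swap (scale2 c g) = scale2 c (swap g)"
  by (auto simp: scale2_def swap_def fun_eq_iff)

lemma shift_scale1: "shift (scale1 c g) = scale1 c (shift g)"
  by (auto simp: scale1_def shift_def fun_eq_iff)

lemma shift2_scale2: "shift2 (scale2 c g) = scale2 c (shift2 g)"
  by (auto simp: scale2_def shift2_def fun_eq_iff)

lemma \<iota>_scale1: "\<iota> (scale1 c g) = scale2 c (\<iota> g)"
  by (auto simp: scale1_def scale2_def \<iota>_def fun_eq_iff)

lemma emb_scale: "emb (c * f) = scale1 c (emb f)"
  by (auto simp: scale1_def emb_def fun_eq_iff)

lemma \<Lambda>_scale1: "c \<in> S \<Longrightarrow> \<Lambda> (scale1 c g) = scale1 c (\<Lambda> g)"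
  by (auto simp: scale1_def \<Lambda>_def fun_eq_iff E_scale Q_scale sum_distrib_left algebra_simps)

lemma D1_scale2: "c \<in> S \<Longrightarrow> D1 (scale2 c g) = scale2 c (D1 g)"
  by (auto simp: scale2_def D1_def E1_def Q1_def N1_def K1_def fun_eq_iff E_scale Q_scale
      sum_distrib_left algebra_simps)

lemma D2_scale2: "c \<in> S \<Longrightarrow> D2 (scale2 c g) = scale2 c (D2 g)"
  by (simp add: D2_def swap_scale2 D1_scale2)

lemma \<Theta>_scale2: "c \<in> S \<Longrightarrow> \<Theta> (scale2 c g) = scale1 c (\<Theta> g)"
  by (auto simp: scale2_def[abs_def] scale1_def \<Theta>_def fun_eq_iff Q_scale sum_distrib_left algebra_simps)

lemma of_nat_S: "of_nat n \<in> S"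
  by (induction n) (auto simp: zero_S one_S add_S)

abbreviation U1 where "U1 n \<equiv> scale1 (u n)"
abbreviation U2 where "U2 n \<equiv> scale2 (u n)"

definition A :: "(nat \<Rightarrow> 'f) \<Rightarrow> nat \<Rightarrow> 'f" where
  "A g = shift (polyop \<Lambda> U1 k g)"

definition A1 :: "(nat \<Rightarrow> nat \<Rightarrow> 'f) \<Rightarrow> nat \<Rightarrow> nat \<Rightarrow> 'f" where
  "A1 g = shift1 (polyop D1 U2 k g)"

definition A2 :: "(nat \<Rightarrow> nat \<Rightarrow> 'f) \<Rightarrow> nat \<Rightarrow> nat \<Rightarrow> 'f" where
  "A2 g = shift2 (polyop D2 U2 k g)"

text \<open>Unlike \<open>D1\<close>, this Cherednik operator commutes with \<open>D2\<close>.\<close>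

definition C1 :: "(nat \<Rightarrow> nat \<Rightarrow> 'f) \<Rightarrow> nat \<Rightarrow> nat \<Rightarrow> 'f" where
  "C1 g = D1 g - swap g"

lemma C1_add: "C1 (g + h) = C1 g + C1 h"
  by (simp add: C1_def D1_add)

lemma C1_scale2: "c \<in> S \<Longrightarrow> C1 (scale2 c g) = scale2 c (C1 g)"
  by (simp add: C1_def D1_scale2 swap_scale2 scale2_diff)

lemma C1_D2: "C1 (D2 g) = D2 (C1 g)"
  by (simp add: C1_def D_commutator D2_diff swap_D2)

lemma polyop_D1_shift2: "polyop D1 U2 n (shift2 g) = shift2 (polyop C1 U2 n g)"
  by (rule polyop_intertwine[where H=shift2, symmetric])
    (simp_all add: D1_shift2 C1_def shift2_scale2 shift2_add)

lemma C1_polyop_D2: "C1 (polyop D2 U2 n g) = polyop D2 U2 n (C1 g)"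
  by (rule polyop_intertwine[where H=C1]) (simp_all add: C1_D2 C1_scale2 u_S C1_add)

text \<open>As \<open>C1\<close> and \<open>D2\<close> commute, the product regroups into pairs
  \<open>(C1 + u) (D2 + u)\<close>. Each pair commutes with \<open>swap\<close>: for
  \<open>C1 + D2 = D1 + D2 - swap\<close> this is symmetry, for \<open>C1 D2\<close> it is
  \<open>D_commutator\<close>.\<close>

lemma swap_polyop_C1_D2: "swap (polyop C1 U2 n (polyop D2 U2 n g)) = polyop C1 U2 n (polyop D2 U2 n (swap g))"
proof (induction n)
  case (Suc n)
  let ?q = "\<lambda>h. D2 h + U2 (Suc n) h" and ?p = "\<lambda>h. C1 h + U2 (Suc n) h"
  have step: "swap (?p (?q h)) = ?p (?q (swap h))" for h
    by (simp add: C1_add C1_def D1_add D1_scale2 u_S scale2_add scale2_diff swap_scale2 swap_D1 swap_D2 D_commutator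
        algebra_simps)
  have "polyop C1 U2 (Suc n) (polyop D2 U2 (Suc n) h) = ?p (?q (polyop C1 U2 n (polyop D2 U2 n h)))" for h
  proof -
    have "?q (polyop C1 U2 n h') = polyop C1 U2 n (?q h')" for h'
      by (rule polyop_intertwine[where H="?q"])
        (simp_all add: C1_add C1_D2 C1_scale2 D2_scale2 D2_add u_S scale2_add scale2_commute algebra_simps)
    then show ?thesis by simp
  qed
  then show ?case
    by (simp only: step Suc)
qed simp

lemma swap_polyop_D1: "swap (polyop D1 U2 n g) = polyop D2 U2 n (swap g)"
  by (rule polyop_intertwine[where H=swap]) (simp_all add: swap_D1 swap_scale2)

lemma swap_A1: "swap (A1 g) = A2 (swap g)"
  by (simp add: A1_def A2_def swap_shift1 swap_polyop_D1)

lemma swap_A2: "swap (A2 g) = A1 (swap g)"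
  by (metis swap_A1 swap_swap)

lemma A1_A2_eq: "A1 (A2 g) = shift1 (shift2 (polyop C1 U2 k (polyop D2 U2 k g)))"
  by (simp add: A1_def A2_def polyop_D1_shift2)

text \<open>By \<open>A1_A2_eq\<close> the composition is \<open>zw\<close> times an operator
  commuting with \<open>swap\<close>, so conjugation by \<open>swap\<close>, which exchanges
  \<open>A1\<close> and \<open>A2\<close>, fixes it.\<close>

lemma A1_A2_commute: "A1 (A2 g) = A2 (A1 g)"
proof -
  have "A2 (A1 g) = swap (A1 (A2 (swap g)))"
    by (simp add: swap_A1 swap_A2)
  also have "\<dots> = A1 (A2 g)"
    by (simp add: A1_A2_eq swap_shift1 swap_shift2 swap_polyop_C1_D2 shift1_shift2)
  finally show ?thesis ..
qed

text \<open>Passing \<open>shift2\<close> turns \<open>D1\<close> into \<open>C1\<close>, which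
  commutes with the factors of \<open>A2\<close>; the \<open>swap\<close> in \<open>C1\<close> gives
  the correction.\<close>

lemma A1_D1_A2: "A1 (D1 (A2 g)) = A2 (A1 (D1 g)) - A2 (A1 (swap g))"
proof -
  have "A1 (D1 (A2 g)) = A1 (A2 (C1 g))"
    by (simp add: A2_def D1_shift2 C1_def[symmetric] C1_polyop_D2)
  moreover have "A1 (A2 (g - h)) = A1 (A2 g) - A1 (A2 h)" for g h
  proof -
    have "A1 (A2 (g + h)) = A1 (A2 g) + A1 (A2 h)" for g h
      unfolding A1_def A2_def
      by (simp add: polyop_add D1_add D2_add scale2_add shift1_add shift2_add)
    from this[of "g - h" h] show ?thesis by simp
  qed
  ultimately show ?thesis
    by (simp add: C1_def A1_A2_commute)
qed

lemma A_add: "A (g + h) = A g + A h"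
  by (simp add: A_def polyop_add \<Lambda>_add scale1_add shift_add)

lemma A1_add: "A1 (g + h) = A1 g + A1 h"
  by (simp add: A1_def polyop_add D1_add scale2_add shift1_add)

lemma A2_add: "A2 (g + h) = A2 g + A2 h"
  by (simp add: A2_def polyop_add D2_add scale2_add shift2_add)

lemma A2_diff: "A2 (g - h) = A2 g - A2 h"
  using A2_add[of "g - h" h] by simp

lemma A1_0: "A1 0 = 0" and A2_0: "A2 0 = 0"
  using A1_add[of 0 0] A2_add[of 0 0] by simp_all

lemma scale1_commute: "scale1 c (scale1 d g) = scale1 d (scale1 c g)"
  by (auto simp: scale1_def fun_eq_iff algebra_simps)

lemma A_scale1:
  assumes "c \<in> S"
  shows "A (scale1 c g) = scale1 c (A g)"
proof -
  have "scale1 c (polyop \<Lambda> U1 k g) = polyop \<Lambda> U1 k (scale1 c g)"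
    by (rule polyop_intertwine[where H="scale1 c"]) (simp_all add: \<Lambda>_scale1 assms scale1_add scale1_commute)
  then show ?thesis by (simp add: A_def shift_scale1[symmetric])
qed

lemma \<iota>_add: "\<iota> (g + h) = \<iota> g + \<iota> h"
  by (auto simp: \<iota>_def fun_eq_iff)

lemma \<iota>_A: "\<iota> (A g) = A1 (\<iota> g)"
proof -
  have "\<iota> (polyop \<Lambda> U1 k g) = polyop D1 U2 k (\<iota> g)"
    by (rule polyop_intertwine[where H=\<iota>]) (simp_all add: \<iota>_\<Lambda> \<iota>_scale1 \<iota>_add)
  then show ?thesis
    by (simp add: A_def A1_def \<iota>_shift)
qed

lemma A_\<Theta>: "A (\<Theta> g) = \<Theta> (A1 g)"
proof -
  have "\<Theta> (polyop D1 U2 k g) = polyop \<Lambda> U1 k (\<Theta> g)"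
    by (rule polyop_intertwine[where H=\<Theta>]) (simp_all add: \<Lambda>_\<Theta> \<Theta>_scale2 \<Theta>_add u_S)
  then show ?thesis
    by (simp add: A_def A1_def shift_\<Theta>[symmetric])
qed

text \<open>\<open>\<Lambda>\<close> commutes with every factor of \<open>A\<close> except the
  shift, so \<open>\<Lambda>_shift\<close> accounts for the whole commutator.\<close>

lemma \<Lambda>_A: "\<Lambda> (A g) = A (\<Lambda> g) + scale1 (1 + b) (A g) + \<Theta> (A2 (swap (\<iota> g)))"
proof -
  have 1: "\<Lambda> (polyop \<Lambda> U1 k g) = polyop \<Lambda> U1 k (\<Lambda> g)"
    by (rule polyop_intertwine[where H=\<Lambda>]) (simp_all add: \<Lambda>_scale1 \<Lambda>_add u_S)
  have "\<iota> (polyop \<Lambda> U1 k g) = polyop D1 U2 k (\<iota> g)"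
    by (rule polyop_intertwine[where H=\<iota>]) (simp_all add: \<iota>_\<Lambda> \<iota>_scale1 \<iota>_add)
  then have 2: "shift2 (swap (\<iota> (polyop \<Lambda> U1 k g))) = A2 (swap (\<iota> g))"
    by (simp add: A2_def swap_polyop_D1)
  show ?thesis
    unfolding A_def \<Lambda>_shift 1 2 by (simp add: scale1_def[abs_def])
qed

section \<open>Commutators with powers of \<open>A\<close>\<close>

abbreviation R :: "nat \<Rightarrow> (nat \<Rightarrow> nat \<Rightarrow> 'f) \<Rightarrow> nat \<Rightarrow> nat \<Rightarrow> 'f" where
  "R \<equiv> mixed_sum A1 A2"

text \<open>The recursion peeling off \<open>A2\<close> instead of \<open>A1\<close>, as needed when
  powers of \<open>A2\<close> grow in \<open>A1_D1_funpow\<close>.\<close>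

lemma R_Suc': "R (Suc m) h = A2 (R m h) + (A1 ^^ Suc m) (A2 h)"
proof (induction m)
  case (Suc m)
  have "R (Suc (Suc m)) h = A1 (A2 (R m h)) + A1 ((A1 ^^ Suc m) (A2 h)) + A1 (A2 ((A2 ^^ Suc m) h))"
    unfolding mixed_sum.simps(2)[of _ _ "Suc m"] Suc by (simp add: A1_add)
  also have "\<dots> = A2 (R (Suc m) h) + A1 ((A1 ^^ Suc m) (A2 h))"
    by (simp add: A2_add A1_A2_commute)
  finally show ?case by (simp only: funpow.simps o_apply)
qed (simp only: mixed_sum.simps A1_0 A2_0 funpow.simps id_apply o_apply add_0_left)

text \<open>Each \<open>A\<close> passed by \<open>\<Lambda>\<close> adds one copy of
  \<open>(1 + b) A ^^ Suc m\<close> and one summand of \<open>R\<close>; the outer \<open>A\<close>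
  act under \<open>\<Theta>\<close> as \<open>A1\<close>.\<close>

lemma A_\<Lambda>_funpow:
  "A (\<Lambda> ((A ^^ m) g)) = (A ^^ m) (A (\<Lambda> g)) + scale1 (of_nat m) (scale1 (1 + b) ((A ^^ Suc m) g)) + \<Theta> (R m (swap (\<iota> g)))"
proof (induction m)
  case 0
  have "\<Theta> 0 = 0" using \<Theta>_add[of 0 0] by simp
  moreover have "scale1 0 h = 0" for h by (auto simp: scale1_def fun_eq_iff)
  ultimately show ?case by (simp only: mixed_sum.simps funpow.simps id_apply of_nat_0 add_0_right)
next
  case (Suc m)
  have "A (\<Lambda> ((A ^^ Suc m) g))
      = A (A (\<Lambda> ((A ^^ m) g)) + scale1 (1 + b) (A ((A ^^ m) g)) + \<Theta> (A2 (swap (\<iota> ((A ^^ m) g)))))"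
    by (simp add: \<Lambda>_A)
  also have "swap (\<iota> ((A ^^ m) g)) = (A2 ^^ m) (swap (\<iota> g))"
    by (simp add: funpow_intertwine[of \<iota> A A1, OF \<iota>_A] funpow_intertwine[of swap A1 A2, OF swap_A1])
  also have "A (A (\<Lambda> ((A ^^ m) g)) + scale1 (1 + b) (A ((A ^^ m) g)) + \<Theta> (A2 ((A2 ^^ m) (swap (\<iota> g)))))
      = A ((A ^^ m) (A (\<Lambda> g))) + (scale1 (of_nat m) (scale1 (1 + b) (A ((A ^^ Suc m) g))) + scale1 (1 + b) (A ((A ^^ Suc m) g)))
        + (\<Theta> (A1 (R m (swap (\<iota> g)))) + \<Theta> (A1 (A2 ((A2 ^^ m) (swap (\<iota> g))))))"
    by (simp only: Suc A_add A_scale1 add_S one_S b_S of_nat_S A_\<Theta> funpow.simps o_apply ac_simps)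
  also have "scale1 (of_nat m) (scale1 (1 + b) h) + scale1 (1 + b) h = scale1 (of_nat (Suc m)) (scale1 (1 + b) h)" for h
    by (auto simp: scale1_def fun_eq_iff algebra_simps)
  finally show ?case
    by (simp only: mixed_sum.simps \<Theta>_add funpow.simps o_apply)
qed

text \<open>The contribution of the other variables, whose \<open>R\<close> cancels the one in
  \<open>A_\<Lambda>_funpow\<close>.\<close>

lemma A1_D1_funpow: "A1 (D1 ((A2 ^^ m) h)) = (A2 ^^ m) (A1 (D1 h)) - R m (swap h)"
proof (induction m)
  case (Suc m)
  have "swap ((A2 ^^ m) h) = (A1 ^^ m) (swap h)"
    by (rule funpow_intertwine[where H=swap]) (rule swap_A2)
  moreover have "A2 (A1 ((A1 ^^ m) (swap h))) = (A1 ^^ Suc m) (A2 (swap h))"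
    using funpow_intertwine[of A2 A1 A1 "Suc m" "swap h"] A1_A2_commute by simp
  ultimately show ?case
    by (simp only: R_Suc' A1_D1_A2 Suc A2_diff funpow.simps o_apply diff_diff_add)
qed simp

definition \<Omega> :: "'f \<Rightarrow> 'f" where
  "\<Omega> f = Q (A (\<Lambda> (emb f)))"

definition B :: "nat \<Rightarrow> 'f \<Rightarrow> 'f" where
  "B m f = Q ((A ^^ m) (emb f))"

lemma Q_minus_fun: "Q (g - h) = Q g - Q h"
  using Q_plus[of "g - h" h] by simp

theorem \<Omega>_B_commutator: "\<Omega> (B m f) - B m (\<Omega> f) = of_nat m * ((1 + b) * B (Suc m) f)"
proof -
  define F where "F = emb f"
  define H where "H = \<iota> F"
  have H: "swap H = H" by (simp add: H_def F_def swap_\<iota>_emb)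
  have iA: "swap (\<iota> ((A ^^ m) F)) = (A2 ^^ m) H"
    using H by (simp add: funpow_intertwine[of \<iota> A A1, OF \<iota>_A] funpow_intertwine[of swap A1 A2, OF swap_A1] H_def)
  \<comment> \<open>\<open>emb_Q\<close> splits \<open>B m f\<close> into the first variable and the
    rest, on which \<open>A\<close> and \<open>\<Lambda>\<close> act under \<open>\<Theta>\<close>
    as \<open>A1\<close> and \<open>D1\<close>.\<close>
  have "\<Omega> (B m f) = Q (A (\<Lambda> ((A ^^ m) F))) + Q (\<Theta> (A1 (D1 ((A2 ^^ m) H))))"
    by (simp add: \<Omega>_def B_def F_def[symmetric] emb_Q iA \<Lambda>_add A_add \<Lambda>_\<Theta> A_\<Theta> Q_plus)
  \<comment> \<open>Splitting \<open>\<Omega> f\<close> instead yields powers of \<open>A1\<close>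
    after a \<open>swap\<close>; \<open>Q_\<Theta>_swap\<close> exchanges the variables to reach the
    same form.\<close>
  moreover have "B m (\<Omega> f) = Q ((A ^^ m) (A (\<Lambda> F))) + Q (\<Theta> ((A2 ^^ m) (A1 (D1 H))))"
  proof -
    have "(A ^^ m) (\<Theta> g) = \<Theta> ((A1 ^^ m) g)" for g
      by (rule funpow_intertwine[where H=\<Theta>, symmetric]) (simp add: A_\<Theta>)
    moreover have "(A1 ^^ m) (swap g) = swap ((A2 ^^ m) g)" for g
      by (rule funpow_intertwine[where H=swap, symmetric]) (rule swap_A2)
    ultimately show ?thesis
      by (simp add: \<Omega>_def B_def F_def[symmetric] emb_Q funpow_additive A_add Q_plus Q_\<Theta>_swap
          \<iota>_A \<iota>_\<Lambda> H_def)
  qed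
  moreover have "Q (scale1 (of_nat m) (scale1 (1 + b) g)) = of_nat m * ((1 + b) * Q g)" for g
    by (simp add: scale1_def[abs_def] Q_scale of_nat_S add_S one_S b_S)
  \<comment> \<open>As \<open>swap H = H\<close>, the two terms \<open>Q (\<Theta> (R m H))\<close>
    cancel.\<close>
  ultimately show ?thesis
    unfolding A_\<Lambda>_funpow A1_D1_funpow H_def[symmetric] H
    by (simp add: \<Theta>_diff Q_plus Q_minus_fun B_def F_def[symmetric])
qed

lemma \<Omega>_scale: "c \<in> S \<Longrightarrow> \<Omega> (c * f) = c * \<Omega> f"
  by (simp add: \<Omega>_def emb_scale \<Lambda>_scale1 A_scale1) (simp add: scale1_def[abs_def] Q_scale)

lemma B_scale:
  assumes "c \<in> S"
  shows "B m (c * f) = c * B m f"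
proof -
  have "scale1 c ((A ^^ m) g) = (A ^^ m) (scale1 c g)" for g
    by (rule funpow_intertwine[where H="scale1 c"]) (simp add: A_scale1 assms)
  then have "B m (c * f) = Q (scale1 c ((A ^^ m) (emb f)))"
    by (simp only: B_def emb_scale)
  also have "\<dots> = c * B m f"
    unfolding scale1_def[abs_def] B_def by (rule Q_scale[OF assms])
  finally show ?thesis .
qed

end

section \<open>Coefficients of polynomials in \<open>p\<close> and \<open>y\<close>\<close>

abbreviation lookup :: "('b \<Rightarrow>\<^sub>0 'c::zero) \<Rightarrow> 'b \<Rightarrow> 'c" where
  "lookup \<equiv> Poly_Mapping.lookup"

lemma sum_fun_app: "(\<Sum>t\<in>T. f t) m = (\<Sum>t\<in>T. f t m)"
  by (induction T rule: infinite_finite_induct) auto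

definition evar :: "var \<Rightarrow> var \<Rightarrow>\<^sub>0 nat" where
  "evar v = Poly_Mapping.single v 1"

lemma lookup_evar: "lookup (evar v) w = (if v = w then 1 else 0)"
  by (simp add: evar_def lookup_single when_def)

lemma evar_add_minus: "lookup k v \<noteq> 0 \<Longrightarrow> evar v + (k - evar v) = k"
  by (rule poly_mapping_eqI) (auto simp: lookup_add lookup_minus lookup_evar)

lemma add_minus_evar [simp]: "k + evar v - evar v = k"
  by (rule poly_mapping_eqI) (auto simp: lookup_add lookup_minus)

lemma lookup_Sum_any:
  assumes "finite {i. h i \<noteq> 0}"
  shows "lookup (Sum_any h) k = Sum_any (\<lambda>i. lookup (h i) k)"
proof -
  have "Sum_any (\<lambda>i. lookup (h i) k) = (\<Sum>i\<in>{i. h i \<noteq> 0}. lookup (h i) k)"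
    by (rule Sum_any.expand_superset) (use assms in auto)
  then show ?thesis
    by (simp add: Sum_any.expand_set lookup_sum)
qed

lemma lookup_Const_times: "lookup (Const c * f) k = c * lookup f k"
proof -
  have "lookup (Const c * f) k = (\<Sum>l. (c * (\<Sum>q. lookup f q when k = l + q)) when l = 0)"
    unfolding lookup_mult Const_def by (rule Sum_any.cong) (simp add: lookup_single when_def)
  also have "\<dots> = c * lookup f k"
    by simp
  finally show ?thesis .
qed

lemma lookup_Var_times: "lookup (Var v * f) k = (if lookup k v = 0 then 0 else lookup f (k - evar v))"
proof -
  have "lookup (Var v * f) k = (\<Sum>l. (\<Sum>q. lookup f q when k = l + q) when l = evar v)"
    unfolding lookup_mult Var_def evar_def by (rule Sum_any.cong) (auto simp: lookup_single when_def)
  also have "\<dots> = (\<Sum>q. lookup f q when k = evar v + q)"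
    by simp
  also have "\<dots> = (if lookup k v = 0 then 0 else lookup f (k - evar v))"
  proof (cases "lookup k v = 0")
    case True
    then have "k \<noteq> evar v + q" for q
      by (auto simp: lookup_add lookup_evar)
    then show ?thesis using True by simp
  next
    case False
    then have "k = evar v + q \<longleftrightarrow> q = k - evar v" for q
      using evar_add_minus[OF False] by (metis add_left_cancel)
    then show ?thesis using False by simp
  qed
  finally show ?thesis .
qed

text \<open>Monomials free of \<open>v\<close> have weight 0 in \<open>pd\<close>, so the truncation
  in \<open>m - evar v\<close> is harmless; otherwise only \<open>m = k + evar v\<close> reaches
  \<open>k\<close>.\<close>

lemma lookup_pd: "lookup (pd v f) k = of_nat (lookup k v + 1) * lookup f (k + evar v)"
proof -
  let ?h = "\<lambda>m. Poly_Mapping.single (m - evar v) (lookup f m * of_nat (lookup m v))"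
  have "finite {m. ?h m \<noteq> 0}"
    by (rule finite_subset[OF _ finite_keys[of f]]) (auto simp: in_keys_iff)
  then have "lookup (pd v f) k = (\<Sum>m. lookup (?h m) k)"
    unfolding pd_def evar_def[symmetric] by (rule lookup_Sum_any)
  also have "\<dots> = (\<Sum>m. (lookup f m * of_nat (lookup m v)) when m = k + evar v)"
  proof (rule Sum_any.cong)
    fix m
    show "lookup (?h m) k = (lookup f m * of_nat (lookup m v) when m = k + evar v)"
    proof (cases "lookup m v = 0")
      case False
      then have "m - evar v = k \<longleftrightarrow> m = k + evar v"
        using evar_add_minus[OF False] by (metis add.commute add_minus_evar)
      then show ?thesis by (simp add: lookup_single when_def)
    qed (simp add: when_def)
  qed
  also have "\<dots> = of_nat (lookup k v + 1) * lookup f (k + evar v)"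
    by (simp add: lookup_add lookup_evar mult.commute)
  finally show ?thesis .
qed

lemma finite_pd_nonzero: "finite {v. pd v f \<noteq> 0}"
proof (rule finite_subset)
  show "{v. pd v f \<noteq> 0} \<subseteq> (\<Union>m\<in>Poly_Mapping.keys f. Poly_Mapping.keys m)"
  proof
    fix v assume "v \<in> {v. pd v f \<noteq> 0}"
    then obtain k where "lookup (pd v f) k \<noteq> 0"
      using poly_mapping_eqI[of "pd v f" 0] by auto
    then have "k + evar v \<in> Poly_Mapping.keys f" "v \<in> Poly_Mapping.keys (k + evar v)"
      by (auto simp: lookup_pd in_keys_iff lookup_add lookup_evar)
    then show "v \<in> (\<Union>m\<in>Poly_Mapping.keys f. Poly_Mapping.keys m)" by blast
  qed
qed simp

lemma finite_pd_P: "finite {i. pd (P i) f \<noteq> 0}"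
  using finite_vimageI[OF finite_pd_nonzero[of f], of P] by (simp add: inj_on_def vimage_def)

lemma finite_pd_Y: "finite {i. pd (Y i) f \<noteq> 0}"
  using finite_vimageI[OF finite_pd_nonzero[of f], of Y] by (simp add: inj_on_def vimage_def)

lemma pd_0 [simp]: "pd v 0 = 0"
  by (rule poly_mapping_eqI) (simp add: lookup_pd)

lemma Sum_any_eq_sum:
  assumes "finite T" "inj_on r T" "\<And>x. g x \<noteq> 0 \<Longrightarrow> x \<in> r ` T"
  shows "Sum_any g = (\<Sum>t\<in>T. g (r t))"
proof -
  have "Sum_any g = sum g (r ` T)"
    by (rule Sum_any.expand_superset) (use assms in auto)
  then show ?thesis
    by (simp add: sum.reindex assms)
qed

section \<open>Polynomials free of y and linear in y\<close>

definition pmon :: "(var \<Rightarrow>\<^sub>0 nat) \<Rightarrow> bool" where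
  "pmon m \<longleftrightarrow> (\<forall>i. lookup m (Y i) = 0)"

text \<open>The shape of \<open>mulY0 b f\<close> for \<open>p_only\<close> \<open>f\<close>, kept
  by \<open>Yplus\<close> and \<open>LambdaY\<close> and sent to \<open>p_only\<close> polynomials
  by \<open>ThetaY\<close>.\<close>

definition y_linear :: "'a::field_char_0 pyp \<Rightarrow> bool" where
  "y_linear f \<longleftrightarrow> (\<forall>m. lookup f m \<noteq> 0 \<longrightarrow> (\<exists>a k. pmon k \<and> m = k + evar (Y a)))"

lemma p_only_alt: "p_only f \<longleftrightarrow> (\<forall>m. lookup f m \<noteq> 0 \<longrightarrow> pmon m)"
  by (simp add: p_only_def pmon_def)

lemma pmon_add_P [simp]: "pmon (m + evar (P i)) \<longleftrightarrow> pmon m"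
  by (simp add: pmon_def lookup_add lookup_evar)

lemma pmon_minus_P [simp]: "pmon (m - evar (P i)) \<longleftrightarrow> pmon m"
  by (simp add: pmon_def lookup_minus lookup_evar)

lemma Sum_any_closed:
  assumes "Q 0" "\<And>f g. Q f \<Longrightarrow> Q g \<Longrightarrow> Q (f + g)" "\<And>i. Q (h i)"
  shows "Q (Sum_any h)"
proof -
  have "Q (sum h T)" for T
    by (induction T rule: infinite_finite_induct) (auto simp: assms)
  then show ?thesis by (simp add: Sum_any.expand_set)
qed

lemma p_only_0 [simp]: "p_only 0"
  by (simp add: p_only_def)

lemma p_only_add: "p_only f \<Longrightarrow> p_only g \<Longrightarrow> p_only (f + g)"
  by (auto simp: p_only_alt lookup_add) (metis add.right_neutral)

lemma p_only_diff: "p_only f \<Longrightarrow> p_only g \<Longrightarrow> p_only (f - g)"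
  by (auto simp: p_only_alt lookup_minus) (metis diff_zero)

lemma y_linear_0 [simp]: "y_linear 0"
  by (simp add: y_linear_def)

lemma y_linear_add: "y_linear f \<Longrightarrow> y_linear g \<Longrightarrow> y_linear (f + g)"
  unfolding y_linear_def lookup_add by (metis add.right_neutral)

lemma p_only_Const_times: "p_only f \<Longrightarrow> p_only (Const c * f)"
  by (auto simp: p_only_alt lookup_Const_times)

lemma y_linear_Const_times: "y_linear f \<Longrightarrow> y_linear (Const c * f)"
  by (auto simp: y_linear_def lookup_Const_times)

lemma p_only_P_times: "p_only f \<Longrightarrow> p_only (Var (P i) * f)"
  by (auto simp: p_only_alt lookup_Var_times)

lemma y_linear_Y_times: "p_only f \<Longrightarrow> y_linear (Var (Y i) * f)"
  unfolding y_linear_def p_only_alt lookup_Var_times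
  by (metis add.commute evar_add_minus)

lemma p_only_pd_P: "p_only f \<Longrightarrow> p_only (pd (P i) f)"
  by (auto simp: p_only_alt lookup_pd)

lemma p_only_pd_Y:
  assumes "y_linear f"
  shows "p_only (pd (Y i) f)"
  unfolding p_only_alt
proof (intro allI impI)
  fix m assume "lookup (pd (Y i) f) m \<noteq> 0"
  then obtain a k where k: "pmon k" "m + evar (Y i) = k + evar (Y a)"
    using assms by (auto simp: lookup_pd y_linear_def)
  have "lookup (m + evar (Y i)) (Y i) \<noteq> 0"
    by (simp add: lookup_add lookup_evar)
  then have "a = i"
    using k by (auto simp: lookup_add lookup_evar pmon_def split: if_splits)
  then show "pmon m"
    using k by (metis add_minus_evar)
qed

lemma p_only_ThetaY: "y_linear f \<Longrightarrow> p_only (ThetaY f)"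
  unfolding ThetaY_def
  by (rule Sum_any_closed) (auto intro: p_only_add p_only_P_times p_only_pd_Y)

lemma y_linear_Yplus: "y_linear f \<Longrightarrow> y_linear (Yplus f)"
  unfolding Yplus_def
  by (rule Sum_any_closed) (auto intro: y_linear_add y_linear_Y_times p_only_pd_Y)

lemma y_linear_LambdaY: "y_linear f \<Longrightarrow> y_linear (LambdaY b f)"
  unfolding LambdaY_def mult.assoc
  by (intro y_linear_add y_linear_Const_times Sum_any_closed[of y_linear])
    (auto simp del: One_nat_def
      intro!: y_linear_add y_linear_Const_times y_linear_Y_times p_only_P_times p_only_pd_Y p_only_pd_P)

lemma y_linear_prodL: "y_linear f \<Longrightarrow> y_linear (prodL b u n f)"
  by (induction n) (auto intro: y_linear_add y_linear_Const_times y_linear_LambdaY)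

lemma y_linear_mulY0: "p_only f \<Longrightarrow> y_linear (mulY0 b f)"
  unfolding mulY0_def mult.assoc by (intro y_linear_Const_times y_linear_Y_times)

lemma p_only_OmegaY: "p_only f \<Longrightarrow> p_only (OmegaY b u k f)"
  unfolding OmegaY_def
  by (intro p_only_ThetaY y_linear_Yplus y_linear_prodL y_linear_LambdaY y_linear_mulY0)

lemma p_only_Bop: "p_only f \<Longrightarrow> p_only (Bop b u k m f)"
proof -
  assume "p_only f"
  then have "y_linear (((Yplus \<circ> prodL b u k) ^^ m) (mulY0 b f))"
    by (induction m) (auto intro: y_linear_mulY0 y_linear_Yplus y_linear_prodL)
  then show ?thesis
    unfolding Bop_def by (intro p_only_Const_times p_only_ThetaY)
qed

section \<open>The Heisenberg action on functions of monomials\<close>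

definition diff_p :: "'a::field_char_0 \<Rightarrow> nat \<Rightarrow> ((var \<Rightarrow>\<^sub>0 nat) \<Rightarrow> 'a) \<Rightarrow> (var \<Rightarrow>\<^sub>0 nat) \<Rightarrow> 'a" where
  "diff_p b i f m = (1 + b) * of_nat i * of_nat (lookup m (P i) + 1) * f (m + evar (P i))"

definition p_indices :: "(var \<Rightarrow>\<^sub>0 nat) \<Rightarrow> nat set" where
  "p_indices m = {j. 1 \<le> j \<and> lookup m (P j) \<noteq> 0}"

text \<open>The coefficient of \<open>m\<close> in the sum of \<open>p_j h_j\<close>: only
  \<open>p_j\<close> dividing \<open>m\<close> contribute, so this is finite for every
  \<open>h\<close>.\<close>

definition p_sum :: "(nat \<Rightarrow> (var \<Rightarrow>\<^sub>0 nat) \<Rightarrow> 'a::field_char_0) \<Rightarrow> (var \<Rightarrow>\<^sub>0 nat) \<Rightarrow> 'a" where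
  "p_sum h m = (\<Sum>j\<in>p_indices m. h j (m - evar (P j)))"

lemma finite_p_indices: "finite (p_indices m)"
proof -
  have "finite {j. lookup m (P j) \<noteq> 0}"
    using finite_vimageI[OF finite_lookup[of m], of P] by (simp add: inj_on_def vimage_def)
  then show ?thesis
    by (rule rev_finite_subset) (auto simp: p_indices_def)
qed

lemma p_sum_commute: "p_sum (\<lambda>i. p_sum (\<lambda>j. G i j)) = p_sum (\<lambda>j. p_sum (\<lambda>i. G i j))"
proof
  fix m
  have *: "p_sum (\<lambda>i. p_sum (\<lambda>j. G i j)) m
      = (\<Sum>(i, j)\<in>(SIGMA i:p_indices m. p_indices (m - evar (P i))). G i j (m - evar (P i) - evar (P j)))" for G
    by (simp add: p_sum_def sum.Sigma finite_p_indices)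
  show "p_sum (\<lambda>i. p_sum (\<lambda>j. G i j)) m = p_sum (\<lambda>j. p_sum (\<lambda>i. G i j)) m"
    unfolding *
    by (rule sum.reindex_bij_witness[where i="\<lambda>(i, j). (j, i)" and j="\<lambda>(i, j). (j, i)"])
      (auto simp: p_indices_def lookup_minus lookup_evar diff_right_commute[of m] split: if_splits)
qed

text \<open>The Leibniz rule. The value \<open>h i m\<close> has weight exponent of
  \<open>p_i\<close> plus one on the left but just the exponent in the first sum on the right; the
  difference is the extra term.\<close>

lemma diff_p_p_sum:
  assumes "1 \<le> i"
  shows "diff_p b i (p_sum h) m = p_sum (\<lambda>j. diff_p b i (h j)) m + of_nat i * (1 + b) * h i m"
proof -
  let ?c = "(1 + b) * of_nat i" and ?n = "m + evar (P i)"
  have idx: "p_indices ?n = insert i (p_indices m)"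
    using assms by (auto simp: p_indices_def lookup_add lookup_evar)
  have neq: "?n - evar (P j) = m - evar (P j) + evar (P i)" if "j \<in> p_indices m" "j \<noteq> i" for j
    by (rule poly_mapping_eqI) (use that in \<open>auto simp: p_indices_def lookup_add lookup_minus lookup_evar\<close>)
  have "diff_p b i (p_sum h) m = ?c * of_nat (lookup m (P i) + 1) * (h i m + (\<Sum>j\<in>p_indices m - {i}. h j (?n - evar (P j))))"
    by (simp add: diff_p_def p_sum_def idx sum.insert_remove finite_p_indices)
  moreover have "p_sum (\<lambda>j. diff_p b i (h j)) m = ?c * of_nat (lookup m (P i)) * h i m
      + (\<Sum>j\<in>p_indices m - {i}. diff_p b i (h j) (m - evar (P j)))"
  proof (cases "i \<in> p_indices m")
    case True
    then have "lookup m (P i) \<noteq> 0" by (simp add: p_indices_def)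
    then have "diff_p b i (h i) (m - evar (P i)) = ?c * of_nat (lookup m (P i)) * h i m"
      using evar_add_minus[of m "P i"] by (simp add: diff_p_def lookup_minus lookup_evar add.commute)
    then show ?thesis
      by (simp add: p_sum_def sum.remove[OF finite_p_indices True])
  next
    case False
    then show ?thesis
      using assms by (simp add: p_sum_def p_indices_def)
  qed
  moreover have "diff_p b i (h j) (m - evar (P j)) = ?c * of_nat (lookup m (P i) + 1) * h j (?n - evar (P j))"
    if "j \<in> p_indices m - {i}" for j
    using that by (simp add: diff_p_def neq lookup_minus lookup_evar)
  ultimately have "diff_p b i (p_sum h) m - p_sum (\<lambda>j. diff_p b i (h j)) m
      = ?c * (of_nat (lookup m (P i) + 1) * h i m) - ?c * (of_nat (lookup m (P i)) * h i m)"
    by (simp only: distrib_left sum_distrib_left mult.assoc cong: sum.cong) simp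
  also have "\<dots> = ?c * h i m"
    by (simp add: algebra_simps)
  finally show ?thesis
    by (simp add: algebra_simps)
qed

text \<open>Products of coefficient functions are pointwise and match polynomial multiplication by a
  scalar when one factor is constant; hence these form \<open>S\<close>.\<close>

definition const_fun :: "'a::field_char_0 \<Rightarrow> (var \<Rightarrow>\<^sub>0 nat) \<Rightarrow> 'a" where
  "const_fun c m = c"

lemma heisenberg_p: "heisenberg (range const_fun) (const_fun b) (\<lambda>n. const_fun (u n)) (diff_p b) p_sum"
proof
  show "(0::(var \<Rightarrow>\<^sub>0 nat) \<Rightarrow> 'a) \<in> range const_fun" "(1::(var \<Rightarrow>\<^sub>0 nat) \<Rightarrow> 'a) \<in> range const_fun"
    by (auto intro: range_eqI[where x=0] range_eqI[where x=1] simp: fun_eq_iff const_fun_def)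
  show "c + d \<in> range const_fun" if "c \<in> range const_fun" "d \<in> range const_fun"
    for c d :: "(var \<Rightarrow>\<^sub>0 nat) \<Rightarrow> 'a"
    using that by (auto simp: fun_eq_iff const_fun_def image_iff)
  show "diff_p b i (f + g) = diff_p b i f + diff_p b i g" for i f g
    by (auto simp: diff_p_def fun_eq_iff algebra_simps)
  show "diff_p b i (c * f) = c * diff_p b i f" if "c \<in> range const_fun" for c i f
    using that by (auto simp: diff_p_def fun_eq_iff const_fun_def)
  show "diff_p b i (diff_p b j f) = diff_p b j (diff_p b i f)" for i j f
    by (auto simp: diff_p_def fun_eq_iff lookup_add lookup_evar ac_simps)
  show "p_sum h = p_sum h'" if "\<And>j. 1 \<le> j \<Longrightarrow> h j = h' j" for h h' :: "nat \<Rightarrow> (var \<Rightarrow>\<^sub>0 nat) \<Rightarrow> 'a"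
    using that by (auto simp: p_sum_def p_indices_def fun_eq_iff intro!: sum.cong)
  show "p_sum (\<lambda>j. h j + h' j) = p_sum h + p_sum h'" for h h' :: "nat \<Rightarrow> (var \<Rightarrow>\<^sub>0 nat) \<Rightarrow> 'a"
    by (auto simp: p_sum_def fun_eq_iff sum.distrib)
  show "p_sum (\<lambda>j. c * h j) = c * p_sum h" if "c \<in> range const_fun"
    for c and h :: "nat \<Rightarrow> (var \<Rightarrow>\<^sub>0 nat) \<Rightarrow> 'a"
    using that by (auto simp: p_sum_def fun_eq_iff const_fun_def sum_distrib_left)
  show "p_sum (\<lambda>i. p_sum (\<lambda>j. G i j)) = p_sum (\<lambda>j. p_sum (\<lambda>i. G i j))"
    for G :: "nat \<Rightarrow> nat \<Rightarrow> (var \<Rightarrow>\<^sub>0 nat) \<Rightarrow> 'a"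
    by (rule p_sum_commute)
  show "diff_p b i (p_sum h) = p_sum (\<lambda>j. diff_p b i (h j)) + of_nat i * (1 + const_fun b) * h i"
    if "1 \<le> i" for i h
    using diff_p_p_sum[OF that] by (auto simp: fun_eq_iff const_fun_def)
qed auto

text \<open>Both maps ignore monomials of higher degree in the \<open>y\<^sub>a\<close>, so they are faithful only on \<open>p_only\<close> and
  \<open>y_linear\<close> polynomials.\<close>

definition p_part :: "'a::field_char_0 pyp \<Rightarrow> (var \<Rightarrow>\<^sub>0 nat) \<Rightarrow> 'a" where
  "p_part f m = (if pmon m then lookup f m else 0)"

definition y_coeff :: "'a::field_char_0 pyp \<Rightarrow> nat \<Rightarrow> (var \<Rightarrow>\<^sub>0 nat) \<Rightarrow> 'a" where
  "y_coeff g a m = (if pmon m then lookup g (m + evar (Y a)) else 0)"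

lemma p_part_eqD: "p_only f \<Longrightarrow> p_only g \<Longrightarrow> p_part f = p_part g \<Longrightarrow> f = g"
  by (rule poly_mapping_eqI) (metis p_only_alt p_part_def)

lemma p_part_diff: "p_part (f - g) = p_part f - p_part g"
  by (auto simp: p_part_def fun_eq_iff lookup_minus)

lemma p_part_Const_times: "p_part (Const c * f) = const_fun c * p_part f"
  by (auto simp: p_part_def fun_eq_iff lookup_Const_times const_fun_def)

lemma y_coeff_add: "y_coeff (f + g) = y_coeff f + y_coeff g"
  by (auto simp: y_coeff_def fun_eq_iff lookup_add)

lemma p_part_ThetaY: "p_part (ThetaY g) = p_sum (y_coeff g)"
proof
  fix m
  show "p_part (ThetaY g) m = p_sum (y_coeff g) m"
  proof (cases "pmon m")
    case True
    have "finite {i. (if 1 \<le> i then Var (P i) * pd (Y i) g else 0) \<noteq> 0}"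
      by (rule finite_subset[OF _ finite_pd_Y[of g]]) auto
    then have "lookup (ThetaY g) m = (\<Sum>i. lookup (if 1 \<le> i then Var (P i) * pd (Y i) g else 0) m)"
      unfolding ThetaY_def by (rule lookup_Sum_any)
    also have "\<dots> = (\<Sum>i\<in>p_indices m. lookup (if 1 \<le> i then Var (P i) * pd (Y i) g else 0) m)"
      by (rule Sum_any_eq_sum[where r="\<lambda>i. i"])
        (use finite_p_indices[of m] in \<open>auto simp: p_indices_def lookup_Var_times split: if_splits\<close>)
    also have "\<dots> = (\<Sum>i\<in>p_indices m. y_coeff g i (m - evar (P i)))"
      using True
      by (intro sum.cong) (auto simp: p_indices_def lookup_Var_times lookup_pd y_coeff_def lookup_minus lookup_evar pmon_def)
    finally show ?thesis
      using True by (simp add: p_part_def p_sum_def)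
  qed (simp add: p_part_def p_sum_def y_coeff_def)
qed

section \<open>Transfer of the polynomial operators to coefficient functions\<close>

context
  fixes b :: "'a::field_char_0" and u :: "nat \<Rightarrow> 'a" and k :: nat
begin

interpretation jack: heisenberg "range const_fun" "const_fun b" "\<lambda>n. const_fun (u n)" k "diff_p b" p_sum
  by (rule heisenberg_p)

lemma y_coeff_Const_times: "y_coeff (Const c * g) = jack.scale1 (const_fun c) (y_coeff g)"
  by (auto simp: y_coeff_def fun_eq_iff lookup_Const_times const_fun_def jack.scale1_def)

lemma y_coeff_Yplus: "y_coeff (Yplus g) = jack.shift (y_coeff g)"
proof (intro ext)
  fix a m
  show "y_coeff (Yplus g) a m = jack.shift (y_coeff g) a m"
  proof (cases "pmon m")
    case True
    let ?n = "m + evar (Y a)"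
    have Y: "lookup ?n (Y i) = (if a = i then 1 else 0)" for i
      using True by (simp add: lookup_add lookup_evar pmon_def)
    have "finite {i. Var (Y (i + 1)) * pd (Y i) g \<noteq> 0}"
      by (rule finite_subset[OF _ finite_pd_Y[of g]]) auto
    then have "lookup (Yplus g) ?n = (\<Sum>i. lookup (Var (Y (i + 1)) * pd (Y i) g) ?n)"
      unfolding Yplus_def by (rule lookup_Sum_any)
    also have "\<dots> = (\<Sum>i\<in>{i. a = i + 1}. lookup (Var (Y (i + 1)) * pd (Y i) g) ?n)"
      by (rule Sum_any_eq_sum[where r="\<lambda>i. i"])
        (auto simp: lookup_Var_times Y intro: finite_subset[of _ "{a - 1}"] split: if_splits)
    also have "\<dots> = jack.shift (y_coeff g) a m"
    proof (cases a)
      case (Suc c)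
      then have "{i. a = i + 1} = {c}" by auto
      with Suc True show ?thesis
        by (simp add: lookup_Var_times lookup_evar lookup_add lookup_pd jack.shift_def y_coeff_def pmon_def)
    qed (simp add: jack.shift_def)
    finally show ?thesis
      using True by (simp add: y_coeff_def)
  qed (simp add: y_coeff_def jack.shift_def)
qed

lemma y_coeff_LambdaY: "y_coeff (LambdaY b g) = jack.\<Lambda> (y_coeff g)"
proof (intro ext)
  fix a m
  show "y_coeff (LambdaY b g) a m = jack.\<Lambda> (y_coeff g) a m"
  proof (cases "pmon m")
    case True
    let ?n = "m + evar (Y a)"
    have Ym: "lookup m (Y i) = 0" for i
      using True by (simp add: pmon_def)
    have Y: "lookup ?n (Y i) = (if a = i then 1 else 0)" for i
      by (simp add: lookup_add lookup_evar Ym)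
    have P: "lookup ?n (P i) = lookup m (P i)" for i
      by (simp add: lookup_add lookup_evar)
    let ?h1 = "\<lambda>(i, j). if i \<ge> 1 \<and> j \<ge> 1 then
         Const (of_nat i) * Var (Y (i + j - 1)) * pd (P i) (pd (Y (j - 1)) g) else 0"
    let ?h2 = "\<lambda>(i, j). if i \<ge> 1 \<and> j \<ge> 1 then Var (Y (i - 1)) * Var (P j) * pd (Y (i + j - 1)) g else 0"
    let ?h3 = "\<lambda>i. Const (of_nat i) * Var (Y i) * pd (Y i) g"
    have "(1 + b) * lookup (Sum_any ?h1) ?n = (\<Sum>i=1..a. diff_p b i (y_coeff g (a - i)) m)"
    proof -
      have "finite {x. ?h1 x \<noteq> 0}"
      proof (rule finite_subset)
        show "{x. ?h1 x \<noteq> 0} \<subseteq> (\<lambda>(j, i). (i, j + 1)) ` (SIGMA j:{j. pd (Y j) g \<noteq> 0}. {i. pd (P i) (pd (Y j) g) \<noteq> 0})"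
        proof
          fix x assume "x \<in> {x. ?h1 x \<noteq> 0}"
          moreover obtain i j where x: "x = (i, j)" by (cases x)
          ultimately have "1 \<le> j" "pd (P i) (pd (Y (j - 1)) g) \<noteq> 0"
            by (auto split: if_splits)
          then show "x \<in> (\<lambda>(j, i). (i, j + 1)) ` (SIGMA j:{j. pd (Y j) g \<noteq> 0}. {i. pd (P i) (pd (Y j) g) \<noteq> 0})"
            unfolding x by (intro image_eqI[where x="(j - 1, i)"]) auto
        qed
        show "finite ((\<lambda>(j, i). (i, j + 1)) ` (SIGMA j:{j. pd (Y j) g \<noteq> 0}. {i. pd (P i) (pd (Y j) g) \<noteq> 0}))"
          by (intro finite_imageI finite_SigmaI finite_pd_Y finite_pd_P)
      qed
      then have "lookup (Sum_any ?h1) ?n = (\<Sum>x. lookup (?h1 x) ?n)"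
        by (rule lookup_Sum_any)
      also have "\<dots> = (\<Sum>i\<in>{1..a}. lookup (?h1 (i, a + 1 - i)) ?n)"
      \<comment> \<open>\<open>Y (i + j - 1) = Y a\<close> forces
        \<open>j = a + 1 - i\<close>.\<close>
      proof (rule Sum_any_eq_sum[where r="\<lambda>i. (i, a + 1 - i)"])
        fix x assume nz: "lookup (?h1 x) ?n \<noteq> 0"
        obtain i j where x: "x = (i, j)" by (cases x)
        with nz have "1 \<le> i" "1 \<le> j" "a = i + j - 1"
          by (auto simp: mult.assoc lookup_Const_times lookup_Var_times Y split: if_splits)
        then show "x \<in> (\<lambda>i. (i, a + 1 - i)) ` {1..a}"
          unfolding x by (intro image_eqI[where x=i]) auto
      qed (auto simp: inj_on_def)
      also have "(1 + b) * \<dots> = (\<Sum>i=1..a. diff_p b i (y_coeff g (a - i)) m)"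
        unfolding sum_distrib_left
      proof (rule sum.cong[OF refl])
        fix i assume i: "i \<in> {1..a}"
        then have "a + 1 - i - 1 = a - i" "i + (a + 1 - i) - 1 = a" "1 \<le> a + 1 - i" by auto
        with i True show "(1 + b) * lookup (?h1 (i, a + 1 - i)) ?n = diff_p b i (y_coeff g (a - i)) m"
          by (simp add: mult.assoc lookup_Const_times lookup_Var_times Y lookup_pd diff_p_def y_coeff_def
              lookup_add lookup_evar Ym)
      qed
      finally show ?thesis .
    qed
    moreover have "lookup (Sum_any ?h2) ?n = p_sum (\<lambda>j. y_coeff g (a + j)) m"
    proof -
      \<comment> \<open>\<open>i + j - 1 \<le> N\<close> bounds both indices.\<close>
      obtain N where N: "\<And>i. pd (Y i) g \<noteq> 0 \<Longrightarrow> i \<le> N"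
        using finite_pd_Y[of g] by (auto simp: finite_nat_set_iff_bounded_le)
      have "finite {x. ?h2 x \<noteq> 0}"
      proof (rule finite_subset)
        show "{x. ?h2 x \<noteq> 0} \<subseteq> {..N + 1} \<times> {..N + 1}"
        proof
          fix x assume "x \<in> {x. ?h2 x \<noteq> 0}"
          moreover obtain i j where x: "x = (i, j)" by (cases x)
          ultimately have "1 \<le> i" "1 \<le> j" "pd (Y (i + j - 1)) g \<noteq> 0"
            by (auto split: if_splits)
          with N[of "i + j - 1"] show "x \<in> {..N + 1} \<times> {..N + 1}"
            unfolding x by auto
        qed
      qed auto
      then have "lookup (Sum_any ?h2) ?n = (\<Sum>x. lookup (?h2 x) ?n)"
        by (rule lookup_Sum_any)
      also have "\<dots> = (\<Sum>j\<in>p_indices m. lookup (?h2 (a + 1, j)) ?n)"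
      \<comment> \<open>Here \<open>Y (i - 1) = Y a\<close> forces \<open>i = a + 1\<close>, and the
        derivative is by \<open>Y (a + j)\<close>.\<close>
      proof (rule Sum_any_eq_sum[where r="\<lambda>j. (a + 1, j)"])
        fix x assume nz: "lookup (?h2 x) ?n \<noteq> 0"
        obtain i j where x: "x = (i, j)" by (cases x)
        with nz have "1 \<le> i" "1 \<le> j" "a = i - 1" "lookup m (P j) \<noteq> 0"
          by (auto simp: mult.assoc lookup_Var_times Y split: if_splits)
        then show "x \<in> (\<lambda>j. (a + 1, j)) ` p_indices m"
          unfolding x by (intro image_eqI[where x=j]) (auto simp: p_indices_def)
      qed (auto simp: inj_on_def finite_p_indices)
      also have "\<dots> = p_sum (\<lambda>j. y_coeff g (a + j)) m"
        unfolding p_sum_def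
        by (rule sum.cong) (use True in \<open>auto simp: p_indices_def mult.assoc lookup_Var_times Y lookup_pd y_coeff_def
              lookup_minus lookup_evar Ym\<close>)
      finally show ?thesis .
    qed
    moreover have "lookup (Sum_any ?h3) ?n = of_nat a * y_coeff g a m"
    proof -
      have "finite {i. ?h3 i \<noteq> 0}"
        by (rule finite_subset[OF _ finite_pd_Y[of g]]) auto
      then have "lookup (Sum_any ?h3) ?n = (\<Sum>i. lookup (?h3 i) ?n)"
        by (rule lookup_Sum_any)
      also have "\<dots> = (\<Sum>i\<in>{a}. lookup (?h3 i) ?n)"
        by (rule Sum_any_eq_sum[where r="\<lambda>i. i"])
          (auto simp: mult.assoc lookup_Const_times lookup_Var_times Y split: if_splits)
      also have "\<dots> = of_nat a * y_coeff g a m"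
        using True by (simp add: mult.assoc lookup_Const_times lookup_Var_times Y lookup_pd y_coeff_def Ym)
      finally show ?thesis .
    qed
    moreover have "(\<Sum>i=1..a. diff_p b i (y_coeff g (a - i))) m = (\<Sum>i=1..a. diff_p b i (y_coeff g (a - i)) m)"
      by (rule sum_fun_app)
    moreover have "y_coeff (LambdaY b g) a m
        = (1 + b) * lookup (Sum_any ?h1) ?n + lookup (Sum_any ?h2) ?n + b * lookup (Sum_any ?h3) ?n"
      using True by (simp only: y_coeff_def LambdaY_def lookup_add lookup_Const_times if_True)
    ultimately show ?thesis
      by (simp only: jack.\<Lambda>_def plus_fun_apply times_fun_apply of_nat_fun_apply const_fun_def)
        (simp only: mult.left_commute)
  next
    case False
    moreover have "(\<Sum>i=1..a. diff_p b i (y_coeff g (a - i))) m = (\<Sum>i=1..a. diff_p b i (y_coeff g (a - i)) m)"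
      by (rule sum_fun_app)
    ultimately show ?thesis
      by (simp add: y_coeff_def jack.\<Lambda>_def diff_p_def p_sum_def)
  qed
qed

lemma y_coeff_prodL: "y_coeff (prodL b u n g) = polyop jack.\<Lambda> (\<lambda>n. jack.scale1 (const_fun (u n))) n (y_coeff g)"
  by (induction n) (simp_all add: y_coeff_add y_coeff_LambdaY y_coeff_Const_times)

lemma y_coeff_mulY0: "y_coeff (mulY0 b f) = jack.emb (const_fun (1 / (1 + b)) * p_part f)"
  by (auto simp: mulY0_def mult.assoc y_coeff_def fun_eq_iff lookup_Const_times lookup_Var_times
      jack.emb_def p_part_def const_fun_def lookup_add lookup_evar pmon_def)

lemma y_coeff_A: "y_coeff (Yplus (prodL b u k g)) = jack.A (y_coeff g)"
  by (simp add: jack.A_def y_coeff_Yplus y_coeff_prodL)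

lemma p_part_Bop: "p_part (Bop b u k m f) = const_fun (fact (m - 1)) * jack.B m (const_fun (1 / (1 + b)) * p_part f)"
proof -
  have "y_coeff (((Yplus \<circ> prodL b u k) ^^ m) g) = (jack.A ^^ m) (y_coeff g)" for g
    by (rule funpow_intertwine[where H=y_coeff]) (simp add: y_coeff_A)
  then show ?thesis
    by (simp add: Bop_def p_part_Const_times p_part_ThetaY y_coeff_mulY0 jack.B_def)
qed

lemma p_part_OmegaY: "p_part (OmegaY b u k f) = jack.\<Omega> (const_fun (1 / (1 + b)) * p_part f)"
  by (simp add: OmegaY_def p_part_ThetaY y_coeff_A y_coeff_LambdaY y_coeff_mulY0 jack.\<Omega>_def)

lemma Bop_Suc:
  assumes "1 + b \<noteq> 0" "m \<ge> 1" "p_only f"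
  shows "Bop b u k (m + 1) f = OmegaY b u k (Bop b u k m f) - Bop b u k m (OmegaY b u k f)"
proof (rule p_part_eqD)
  let ?c = "const_fun (1 / (1 + b)) :: (var \<Rightarrow>\<^sub>0 nat) \<Rightarrow> 'a"
    and ?d = "const_fun (fact (m - 1)) :: (var \<Rightarrow>\<^sub>0 nat) \<Rightarrow> 'a"
  define F where "F = ?c * p_part f"
  \<comment> \<open>\<open>OmegaY\<close> and \<open>Bop\<close> each bring a factor
    \<open>1 / (1 + b)\<close>: one sits in \<open>F\<close>, the other cancels the
    \<open>1 + b\<close> of the commutator, and \<open>m\<close> turns \<open>fact (m - 1)\<close>
    into \<open>fact m\<close>.\<close>
  have "p_part (OmegaY b u k (Bop b u k m f) - Bop b u k m (OmegaY b u k f))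
      = ?c * (?d * (jack.\<Omega> (jack.B m F) - jack.B m (jack.\<Omega> F)))"
    by (simp add: p_part_diff p_part_OmegaY p_part_Bop F_def[symmetric] jack.\<Omega>_scale jack.B_scale right_diff_distrib mult.left_commute)
  also have "\<dots> = ?c * (1 + const_fun b) * (of_nat m * ?d) * jack.B (Suc m) F"
    by (simp add: jack.\<Omega>_B_commutator algebra_simps)
  also have "?c * (1 + const_fun b) = 1"
    using assms by (auto simp: fun_eq_iff const_fun_def)
  also have "of_nat m * ?d = const_fun (fact m)"
    using assms by (auto simp: fun_eq_iff const_fun_def fact_reduce)
  finally show "p_part (Bop b u k (m + 1) f) = p_part (OmegaY b u k (Bop b u k m f) - Bop b u k m (OmegaY b u k f))"
    by (simp only: p_part_Bop F_def Suc_eq_plus1 add_diff_cancel_right' mult_1_left)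
qed (use assms in \<open>auto intro: p_only_Bop p_only_OmegaY p_only_diff\<close>)

end

theorem theorem4p10:
  fixes b :: "'a::field_char_0" and u :: "nat \<Rightarrow> 'a" and k :: nat
  assumes "k \<ge> 1" and "1 + b \<noteq> 0"
  shows "(\<forall>f. p_only f \<longrightarrow> Bop b u k 1 f = ThetaY (Yplus (prodL b u k (mulY0 b f))))
       \<and> (\<forall>m f. m \<ge> 1 \<longrightarrow> p_only f \<longrightarrow>
            Bop b u k (m + 1) f = OmegaY b u k (Bop b u k m f) - Bop b u k m (OmegaY b u k f))"
proof (intro conjI allI impI)
  have "Const (1::'a) = 1"
    by (simp add: Const_def)
  then show "Bop b u k 1 f = ThetaY (Yplus (prodL b u k (mulY0 b f)))" for f
    by (simp add: Bop_def)
qed (rule Bop_Suc[OF assms(2)])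

end
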